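(* Let $n\ge 2$ and let $T_{reg}^{\infty}=E_0E_1\dots E_n$ be a totally asymptotic regular simplex in $\overline{\mathbf{H}}^n$. Consider the generalized simplicial horoball density $\delta(\mathcal{B})$ over all admissible horoball arrangements $\mathcal{B}=\{B_0,\dots,B_n\}$ for $T_{reg}^{\infty}$. If $n=2$ or $n=3$, then the maximum of $\delta(\mathcal{B})$ is realized both at the arrangement $\mathcal{B}_0^n$ and at the arrangement $\mathcal{B}_1^n$. If $n\ge 4$, then the maximum of $\delta(\mathcal{B})$ is attained at the arrangement $\mathcal{B}_1^n$.
   Context: $\mathbf{H}^n$ is hyperbolic $n$-space of constant sectional curvature $-1$, and $\overline{\mathbf{H}}^n$ is $\mathbf{H}^n$ together with its boundary at infinity $\partial\mathbf{H}^n$. A totally asymptotic (ideal) simplex $T=E_0E_1\dots E_n$ is an $n$-simplex all of whose vertices $E_i$ lie on $\partial\mathbf{H}^n$; it is regular if its symmetry group acts transitively on the $k$-dimensional faces for every $0\le k\le n-1$. An admissible horoball arrangement for $T$ is a family $\mathcal{B}=\{B_0,\dots,B_n\}$ of horoballs, with $B_i$ having ideal center $E_i$, such that (i) the horoballs form a packing, i.e. they do not overlap (their interiors are pairwise disjoint; tangency is allowed), and (ii) for each $i$, the horoball $B_i$ meets the hyperplane spanned by the vertices $E_j$, $j\neq i$, in at most one point (so it may touch this hyperplane). The horoballs at different vertices are not required to be of the same "type" (i.e. to occupy equal volumes in $T$). The generalized simplicial horoball density is $$\delta(\mathcal{B})=\frac{\sum_{i=0}^{n}\mathrm{vol}(B_i\cap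 T)}{\mathrm{vol}(T)}.$$ For the totally asymptotic regular simplex $T_{reg}^{\infty}=E_0\dots E_n$, two particular arrangements are defined: - $\mathcal{B}_0^n$: all $n+1$ horoballs are of the same type (all volumes $\mathrm{vol}(B_i\cap T_{reg}^\infty)$ are equal) and any two of them are tangent to each other (at the "midpoint" of the edge joining their centers). - $\mathcal{B}_1^n$: the horoball $B_n$ centered at $E_n$ is tangent to the opposite face $E_0E_1\dots E_{n-1}$ of $T_{reg}^\infty$, and each of the other $n$ horoballs $B_i$, centered at $E_i$ ($0\le i\le n-1$), is tangent to $B_n$. *)

theory Defs
  imports "HOL-Analysis.Analysis"
begin

text \<open>
  Hyperbolic space of dimension \<open>n = DIM('a)\<close> in the projective (Cayley-Klein) model: its points are
  those of \<open>ball 0 1\<close>, its boundary at infinity is \<open>sphere 0 1\<close>, and its geodesics and hyperplanes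
  are the traces of Euclidean lines and hyperplanes.  Hence the simplex with given vertices in
  \<open>cball 0 1\<close> is their Euclidean convex hull and the hyperplane they span is their affine hull.

  The vertices of an \<open>n\<close>-simplex are \<open>E 0, \<dots>, E n\<close>; values of \<open>E\<close> (and of a family \<open>B\<close> of
  horoballs) at indices beyond \<open>n\<close> are irrelevant.
\<close>

definition hdist :: "'a::euclidean_space \<Rightarrow> 'a \<Rightarrow> real" where
  "hdist x y = arcosh ((1 - x \<bullet> y) / (sqrt (1 - (norm x)\<^sup>2) * sqrt (1 - (norm y)\<^sup>2)))"

text \<open>The Riemannian volume of curvature -1: in the Klein model the metric tensor has
  determinant \<open>(1 - |x|\<^sup>2) ^ -(n + 1)\<close>.\<close>

definition hyp_measure :: "'a::euclidean_space measure" where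
  "hyp_measure = density lborel
     (\<lambda>x. ennreal (indicator (ball 0 1) x * (1 - (norm x)\<^sup>2) powr (- (real DIM('a) + 1) / 2)))"

definition hvol :: "'a::euclidean_space set \<Rightarrow> real" where
  "hvol S = measure hyp_measure S"

text \<open>An isometry of hyperbolic space together with its continuous extension to the boundary
  at infinity.\<close>

definition hyp_isometry :: "('a::euclidean_space \<Rightarrow> 'a) \<Rightarrow> bool" where
  "hyp_isometry f \<longleftrightarrow>
     continuous_on (cball 0 1) f \<and> bij_betw f (ball 0 1) (ball 0 1) \<and>
     (\<forall>x\<in>ball 0 1. \<forall>y\<in>ball 0 1. hdist (f x) (f y) = hdist x y)"

definition face :: "(nat \<Rightarrow> 'a::euclidean_space) \<Rightarrow> nat set \<Rightarrow> 'a set" where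
  "face E I = convex hull (E ` I)"

definition simplex_of :: "(nat \<Rightarrow> 'a::euclidean_space) \<Rightarrow> 'a set" where
  "simplex_of E = face E {..DIM('a)}"

definition face_hyperplane :: "(nat \<Rightarrow> 'a::euclidean_space) \<Rightarrow> nat \<Rightarrow> 'a set" where
  "face_hyperplane E i = affine hull (E ` ({..DIM('a)} - {i})) \<inter> ball 0 1"

definition ideal_simplex :: "(nat \<Rightarrow> 'a::euclidean_space) \<Rightarrow> bool" where
  "ideal_simplex E \<longleftrightarrow>
     (\<forall>i\<le>DIM('a). norm (E i) = 1) \<and>
     inj_on E {..DIM('a)} \<and> \<not> affine_dependent (E ` {..DIM('a)})"

definition simplex_symmetry :: "(nat \<Rightarrow> 'a::euclidean_space) \<Rightarrow> ('a \<Rightarrow> 'a) \<Rightarrow> bool" where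
  "simplex_symmetry E f \<longleftrightarrow> hyp_isometry f \<and> f ` simplex_of E = simplex_of E"

definition regular_ideal_simplex :: "(nat \<Rightarrow> 'a::euclidean_space) \<Rightarrow> bool" where
  "regular_ideal_simplex E \<longleftrightarrow>
     ideal_simplex E \<and>
     (\<forall>k<DIM('a). \<forall>I J. I \<subseteq> {..DIM('a)} \<and> card I = k + 1 \<and> J \<subseteq> {..DIM('a)} \<and> card J = k + 1 \<longrightarrow>
        (\<exists>f. simplex_symmetry E f \<and> f ` face E I = face E J))"

text \<open>The Busemann function of the ideal point \<open>e\<close>, normalized to vanish at the origin, in closed
  form; lemma \<open>hdist_diff_tendsto_busemann\<close> below recovers its usual definition as a limit.\<close>

definition busemann :: "'a::euclidean_space \<Rightarrow> 'a \<Rightarrow> real" where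
  "busemann e x = ln ((1 - e \<bullet> x) / sqrt (1 - (norm x)\<^sup>2))"

text \<open>Horoballs are closed in hyperbolic space and do not contain their ideal center.\<close>

definition is_horoball :: "'a::euclidean_space \<Rightarrow> 'a set \<Rightarrow> bool" where
  "is_horoball e B \<longleftrightarrow> (\<exists>c. B = {x \<in> ball 0 1. busemann e x \<le> c})"

definition horoball_family :: "(nat \<Rightarrow> 'a::euclidean_space) \<Rightarrow> (nat \<Rightarrow> 'a set) \<Rightarrow> bool" where
  "horoball_family E B \<longleftrightarrow> (\<forall>i\<le>DIM('a). is_horoball (E i) (B i))"

definition admissible :: "(nat \<Rightarrow> 'a::euclidean_space) \<Rightarrow> (nat \<Rightarrow> 'a set) \<Rightarrow> bool" where
  "admissible E B \<longleftrightarrow>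
     horoball_family E B \<and>
     (\<forall>i\<le>DIM('a). \<forall>j\<le>DIM('a). i \<noteq> j \<longrightarrow> interior (B i) \<inter> interior (B j) = {}) \<and>
     (\<forall>i\<le>DIM('a). \<exists>p. B i \<inter> face_hyperplane E i \<subseteq> {p})"

definition horoball_density :: "(nat \<Rightarrow> 'a::euclidean_space) \<Rightarrow> (nat \<Rightarrow> 'a set) \<Rightarrow> real" where
  "horoball_density E B = (\<Sum>i\<le>DIM('a). hvol (B i \<inter> simplex_of E)) / hvol (simplex_of E)"

definition density_maximal :: "(nat \<Rightarrow> 'a::euclidean_space) \<Rightarrow> (nat \<Rightarrow> 'a set) \<Rightarrow> bool" where
  "density_maximal E B \<longleftrightarrow>
     admissible E B \<and> (\<forall>B'. admissible E B' \<longrightarrow> horoball_density E B' \<le> horoball_density E B)"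

text \<open>Two horoballs with distinct ideal centers are tangent iff they have exactly one common point;
  this point then lies on the geodesic joining the centers.\<close>

definition horoballs_tangent :: "'a::euclidean_space set \<Rightarrow> 'a set \<Rightarrow> bool" where
  "horoballs_tangent B C \<longleftrightarrow> (\<exists>p. B \<inter> C = {p})"

definition tangent_to_face :: "(nat \<Rightarrow> 'a::euclidean_space) \<Rightarrow> nat \<Rightarrow> 'a set \<Rightarrow> bool" where
  "tangent_to_face E i B \<longleftrightarrow>
     (\<exists>p. B \<inter> face_hyperplane E i = {p} \<and> p \<in> face E ({..DIM('a)} - {i}))"

text \<open>The two distinguished arrangements: \<open>arrangement0\<close> (same type, mutually tangent) and
  \<open>arrangement1\<close>, in which the horoball at \<open>E n\<close> plays the special role.\<close>

definition arrangement0 :: "(nat \<Rightarrow> 'a::euclidean_space) \<Rightarrow> (nat \<Rightarrow> 'a set) \<Rightarrow> bool" where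
  "arrangement0 E B \<longleftrightarrow>
     horoball_family E B \<and>
     (\<forall>i\<le>DIM('a). \<forall>j\<le>DIM('a). hvol (B i \<inter> simplex_of E) = hvol (B j \<inter> simplex_of E)) \<and>
     (\<forall>i\<le>DIM('a). \<forall>j\<le>DIM('a). i \<noteq> j \<longrightarrow> horoballs_tangent (B i) (B j))"

definition arrangement1 :: "(nat \<Rightarrow> 'a::euclidean_space) \<Rightarrow> (nat \<Rightarrow> 'a set) \<Rightarrow> bool" where
  "arrangement1 E B \<longleftrightarrow>
     horoball_family E B \<and>
     tangent_to_face E DIM('a) (B DIM('a)) \<and>
     (\<forall>i<DIM('a). horoballs_tangent (B i) (B DIM('a)))"

lemma hdist_diff_tendsto_busemann:
  fixes e x :: "'a::euclidean_space"
  assumes e: "norm e = 1" and x: "x \<in> ball 0 1"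
  shows "((\<lambda>r. hdist x (r *\<^sub>R e) - hdist 0 (r *\<^sub>R e)) \<longlongrightarrow> busemann e x) (at_left 1)"
proof -
  define s where "s = sqrt (1 - (norm x)\<^sup>2)"
  have nx: "norm x < 1" using x by simp
  have s: "s > 0" unfolding s_def using nx by (simp add: power_less_one_iff abs_square_less_1)
  have ex: "e \<bullet> x < 1"
    using norm_cauchy_schwarz[of e x] e nx by simp
  define U where "U = (\<lambda>r. (1 - r * (e \<bullet> x)) / s)"
  define q where "q = (\<lambda>r::real. sqrt (1 - r\<^sup>2))"
  define a where "a = (1 - e \<bullet> x) / s"
  have a: "a > 0" unfolding a_def using ex s by simp
  have U: "(U \<longlongrightarrow> a) (at_left 1)"
    unfolding U_def a_def using s by (auto intro!: tendsto_eq_intros)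
  have q: "(q \<longlongrightarrow> 0) (at_left 1)"
    unfolding q_def by (auto intro!: tendsto_eq_intros)
  have "((\<lambda>r. U r - q r) \<longlongrightarrow> a - 0) (at_left 1)"
    by (intro tendsto_diff U q)
  hence ev1: "\<forall>\<^sub>F r in at_left 1. U r - q r > 0"
    using a by (intro order_tendstoD(1)[where a = 0]) auto
  have ev2: "\<forall>\<^sub>F r in at_left 1. r \<in> {0<..<1::real}"
    by (rule eventually_at_leftI[of 0]) auto
  have lim: "((\<lambda>r. ln ((U r + sqrt ((U r)\<^sup>2 - (q r)\<^sup>2)) / (1 + sqrt (1 - (q r)\<^sup>2)))) \<longlongrightarrow>
        ln ((a + sqrt (a\<^sup>2 - 0\<^sup>2)) / (1 + sqrt (1 - 0\<^sup>2)))) (at_left 1)"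
    using a by (intro tendsto_intros U q) auto
  have "ln ((a + sqrt (a\<^sup>2 - 0\<^sup>2)) / (1 + sqrt (1 - 0\<^sup>2))) = busemann e x"
    using a unfolding busemann_def s_def[symmetric] a_def[symmetric] by simp
  moreover have "\<forall>\<^sub>F r in at_left 1.
      ln ((U r + sqrt ((U r)\<^sup>2 - (q r)\<^sup>2)) / (1 + sqrt (1 - (q r)\<^sup>2)))
      = hdist x (r *\<^sub>R e) - hdist 0 (r *\<^sub>R e)"
    using ev1 ev2
  proof eventually_elim
    case (elim r)
    have r: "0 < r" "r < 1" using elim by auto
    have q1: "q r > 0" "q r \<le> 1"
      unfolding q_def using r by (auto simp: power_less_one_iff abs_square_less_1)
    have Uq: "U r / q r \<ge> 1" "1 / q r \<ge> 1" using elim q1 by (auto simp: field_simps)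
    have ac: "arcosh (u / q r) = ln ((u + sqrt (u\<^sup>2 - (q r)\<^sup>2)) / q r)" if "u / q r \<ge> 1" for u
    proof -
      have "sqrt ((u / q r)\<^sup>2 - 1) = sqrt (u\<^sup>2 - (q r)\<^sup>2) / q r"
      proof -
        have "(u / q r)\<^sup>2 - 1 = (u\<^sup>2 - (q r)\<^sup>2) / (q r)\<^sup>2"
          using q1 by (simp add: field_simps)
        thus ?thesis using q1 by (simp add: real_sqrt_divide)
      qed
      thus ?thesis using that by (simp add: arcosh_real_def add_divide_distrib)
    qed
    have 1: "hdist x (r *\<^sub>R e) = arcosh (U r / q r)"
      using e r by (simp add: hdist_def U_def q_def s_def inner_commute)
    have 2: "hdist 0 (r *\<^sub>R e) = arcosh (1 / q r)"
      using e r by (simp add: hdist_def q_def)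
    have sq: "(q r)\<^sup>2 \<le> 1" using q1 by (simp add: power_le_one)
    have sU: "(q r)\<^sup>2 \<le> (U r)\<^sup>2" using elim q1 by (intro power_mono) auto
    have pos: "U r + sqrt ((U r)\<^sup>2 - (q r)\<^sup>2) > 0" "1 + sqrt (1 - (q r)\<^sup>2) > 0"
      using elim q1 sq sU by (auto intro!: add_pos_nonneg)
    show ?case
      unfolding 1 2 ac[OF Uq(1)] ac[OF Uq(2)]
      using pos q1 by (simp add: ln_div)
  qed
  ultimately show ?thesis
    using Lim_transform_eventually[OF lim] by simp
qed

end

theory Submission
  imports Defs
begin

text \<open>
  Each ideal vertex \<open>E i\<close> is the ray of the light-like vector \<open>(1, E i)\<close> of Minkowski space.
  A symmetry of the simplex acts on these rays linearly, so it multiplies the products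
  \<open>1 - E i \<bullet> E j\<close> by factors \<open>c i * c j\<close>. Because the symmetry group is transitive on edges,
  the vectors can be rescaled by positive \<open>t i\<close> so that all pairwise products become equal
  to one (\<open>regular_ideal_simplex_gauge\<close>). From then on only the Gram matrix \<open>J - I\<close> of the
  vectors \<open>t i * (1, E i)\<close> matters (0 on the diagonal, 1 off it), and the position of the
  simplex in the ball is forgotten; this is the locale \<open>gauged_simplex\<close>.

  A horoball at \<open>E i\<close> is the set of unit time-like vectors whose product with \<open>t i * (1, E i)\<close> is at
  most some \<open>r i > 0\<close>. In terms of these radii, with \<open>n\<close> the dimension:
  \<^item> two horoballs do not overlap iff \<open>r i * r j \<le> 1/2\<close>, with equality exactly for tangency
    (\<open>horoballs_not_overlapping_iff\<close>, \<open>horoballs_tangent_iff\<close>);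
  \<^item> a horoball does not cross the opposite hyperplane iff \<open>(r i)\<^sup>2 \<le> n / (n - 1)\<close>, with equality
    exactly for tangency, the contact point being the centre of the face
    (\<open>horoball_within_face_iff\<close>, \<open>tangent_to_face_iff\<close>);
  \<^item> as long as it does not cross that hyperplane, it cuts out of the simplex the volume
    \<open>C * r i ^ (n - 1)\<close>, with the same \<open>C\<close> for all vertices (\<open>hvol_horoball_sector\<close>).

  Put \<open>u i = (sqrt 2 * r i) ^ (n - 1)\<close>. The density is a constant multiple of the sum of the
  \<open>u i\<close>, the packing condition reads \<open>u i * u j \<le> 1\<close>, and the face condition \<open>u i \<le> M\<close> with
  \<open>M\<^sup>2 = (2 * n / (n - 1)) ^ (n - 1)\<close>. If no \<open>u i\<close> exceeds 1, the sum is at most \<open>n + 1\<close>. If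
  the largest \<open>u i\<close> is some \<open>v \<ge> 1\<close>, the others are at most \<open>1 / v\<close>, and the sum is at most
  \<open>v + n / v\<close>. This is convex in \<open>v\<close>, hence at most the larger of its values \<open>n + 1\<close> and
  \<open>M + n / M\<close> at the ends of \<open>[1, M]\<close>; the second one wins because \<open>M \<ge> n\<close>
  (\<open>sum_le_of_pairwise_products\<close>, \<open>dim_le_max_weight\<close>), and the two agree iff \<open>M = n\<close>, as happens
  for \<open>n = 2\<close> and \<open>n = 3\<close>. The value \<open>n + 1\<close> belongs to \<open>arrangement0\<close>, where all \<open>u i = 1\<close>,
  and \<open>M + n / M\<close> to \<open>arrangement1\<close>, where one \<open>u i\<close> is \<open>M\<close> and the others are \<open>1 / M\<close>.

  The volume formula is where the analysis lies. Hyperbolic volume in the Klein model is, up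
  to the factor \<open>n + 1\<close>, the Lebesgue measure of the truncated cone over a set in
  \<open>real \<times> 'a\<close> (\<open>emeasure_hyp_measure_cone\<close>). Cones may be moved by arbitrary linear maps,
  which scale Lebesgue measure by a constant, so the computation can be done in the
  coordinates given by the vectors \<open>t i * (1, E i)\<close>. There the cone of a horoball sector is
  a standard region depending only on \<open>r i\<close> and on which coordinate is singled out, and
  Fubini's theorem along this coordinate shows how its measure scales with \<open>r i\<close>.
\<close>

section \<open>Lebesgue measure under linear maps\<close>

lemma nn_integral_lborel_translate:
  fixes h :: "'v::euclidean_space \<Rightarrow> ennreal"
  assumes [measurable]: "h \<in> borel_measurable borel"
  shows "(\<integral>\<^sup>+x. h (a + x) \<partial>lborel) = (\<integral>\<^sup>+x. h x \<partial>lborel)"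
proof -
  have "(\<integral>\<^sup>+x. h x \<partial>lborel) = (\<integral>\<^sup>+x. h x \<partial>distr lborel borel ((+) a))"
    by (simp add: lborel_distr_plus)
  also have "\<dots> = (\<integral>\<^sup>+x. h (a + x) \<partial>lborel)"
    by (subst nn_integral_distr) auto
  finally show ?thesis by simp
qed

lemma nn_integral_lborel_scale:
  fixes h :: "'v::euclidean_space \<Rightarrow> ennreal"
  assumes [measurable]: "h \<in> borel_measurable borel" and c: "c > 0"
  shows "(\<integral>\<^sup>+x. h x \<partial>lborel) = ennreal (c ^ DIM('v)) * (\<integral>\<^sup>+x. h (c *\<^sub>R x) \<partial>lborel)"
proof -
  have "(\<integral>\<^sup>+x. h x \<partial>lborel)
      = (\<integral>\<^sup>+x. h x \<partial>density (distr lborel borel (\<lambda>x. 0 + c *\<^sub>R x)) (\<lambda>_. \<bar>c\<bar> ^ DIM('v)))"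
    using c by (subst lborel_affine[of c 0]) auto
  also have "\<dots> = (\<integral>\<^sup>+x. ennreal (\<bar>c\<bar> ^ DIM('v)) * h (c *\<^sub>R x) \<partial>lborel)"
    by (simp add: nn_integral_density nn_integral_distr)
  also have "\<dots> = ennreal (c ^ DIM('v)) * (\<integral>\<^sup>+x. h (c *\<^sub>R x) \<partial>lborel)"
    using c by (subst nn_integral_cmult) auto
  finally show ?thesis .
qed

text \<open>
  Uniqueness of translation-invariant measures, up to a factor. With \<open>Q\<close> the unit cube, the
  double integral of \<open>\<lambda>x y. indicator Q x * indicator A (x + f y)\<close> is the measure of
  \<open>f -` A\<close> when \<open>y\<close> is integrated first, and a constant times the measure of \<open>A\<close> when \<open>x\<close>
  is.
\<close>
lemma linear_vimage_lborel:
  fixes f g :: "'v::euclidean_space \<Rightarrow> 'v"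
  assumes f: "linear f" and g: "linear g" and fg: "\<And>x. f (g x) = x"
  obtains c :: ennreal where
    "\<And>A. A \<in> sets borel \<Longrightarrow> emeasure lborel (f -` A) = c * emeasure lborel A"
proof -
  have [measurable]: "f \<in> borel_measurable borel" "g \<in> borel_measurable borel"
    using f g by (auto intro!: borel_measurable_continuous_onI linear_continuous_on
        simp: linear_conv_bounded_linear)
  define Q :: "'v set" where "Q = cbox 0 One"
  have [measurable]: "Q \<in> sets borel" by (simp add: Q_def)
  have Q1: "emeasure lborel Q = 1" by (simp add: Q_def)
  define c where "c = (\<integral>\<^sup>+y. indicator Q (- f y) \<partial>lborel)"
  have "emeasure lborel (f -` A) = c * emeasure lborel A"
    if [measurable]: "A \<in> sets borel" for A
  proof -
    have pm: "(\<lambda>(x, y). indicator Q x * indicator A (x + f y) :: ennreal)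
        \<in> borel_measurable (lborel \<Otimes>\<^sub>M lborel)"
      by measurable
    have pm2: "(\<lambda>(x, y). indicator Q (x - f y) * indicator A x :: ennreal)
        \<in> borel_measurable (lborel \<Otimes>\<^sub>M lborel)"
      by measurable
    have vm: "f -` A \<in> sets borel" using measurable_sets[of f borel borel A] by simp
    have 1: "(\<integral>\<^sup>+y. indicator A (x + f y) \<partial>lborel) = emeasure lborel (f -` A)" for x
    proof -
      have "(\<integral>\<^sup>+y. indicator A (x + f y) \<partial>lborel) = (\<integral>\<^sup>+y. indicator A (f (g x + y)) \<partial>lborel)"
        by (simp add: linear_add[OF f] fg)
      also have "\<dots> = (\<integral>\<^sup>+y. indicator A (f y) \<partial>lborel)"
        by (rule nn_integral_lborel_translate) measurable
      also have "\<dots> = (\<integral>\<^sup>+y. indicator (f -` A) y \<partial>lborel)"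
        by (simp add: indicator_def)
      finally show ?thesis using vm by simp
    qed
    \<comment> \<open>Translating \<open>y\<close> by \<open>g x\<close> removes \<open>x\<close> from the integrand.\<close>
    have 2: "(\<integral>\<^sup>+y. indicator Q (x - f y) \<partial>lborel) = c" for x
    proof -
      have "c = (\<integral>\<^sup>+y. indicator Q (- f (- g x + y)) \<partial>lborel)"
        unfolding c_def by (rule nn_integral_lborel_translate[symmetric]) measurable
      moreover have "- f (- g x + y) = x - f y" for y
        by (simp only: linear_add[OF f] linear_neg[OF f] fg) simp
      ultimately show ?thesis by simp
    qed
    have 3: "(\<integral>\<^sup>+x. indicator Q x * indicator A (x + z) \<partial>lborel) =
        (\<integral>\<^sup>+x. indicator Q (x - z) * indicator A x \<partial>lborel)" for z
      using nn_integral_lborel_translate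
        [of "\<lambda>x. indicator Q x * indicator A (x + z)" "-z"]
      by (simp add: add.commute)
    have "emeasure lborel (f -` A) = (\<integral>\<^sup>+x. indicator Q x * emeasure lborel (f -` A) \<partial>lborel)"
      by (simp add: nn_integral_multc Q1)
    also have "\<dots> = (\<integral>\<^sup>+x. \<integral>\<^sup>+y. indicator Q x * indicator A (x + f y) \<partial>lborel \<partial>lborel)"
      by (simp add: nn_integral_cmult 1)
    also have "\<dots> = (\<integral>\<^sup>+y. \<integral>\<^sup>+x. indicator Q x * indicator A (x + f y) \<partial>lborel \<partial>lborel)"
      by (rule lborel_pair.Fubini'[OF pm, symmetric])
    also have "\<dots> = (\<integral>\<^sup>+y. \<integral>\<^sup>+x. indicator Q (x - f y) * indicator A x \<partial>lborel \<partial>lborel)"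
      by (simp add: 3)
    also have "\<dots> = (\<integral>\<^sup>+x. \<integral>\<^sup>+y. indicator Q (x - f y) * indicator A x \<partial>lborel \<partial>lborel)"
      by (rule lborel_pair.Fubini'[OF pm2])
    also have "\<dots> = (\<integral>\<^sup>+x. c * indicator A x \<partial>lborel)"
      by (simp add: nn_integral_multc 2)
    also have "\<dots> = c * emeasure lborel A"
      by (simp add: nn_integral_cmult)
    finally show ?thesis .
  qed
  thus ?thesis using that by blast
qed

text \<open>
  The scaling constant is 1 because the unit ball is mapped onto itself.
\<close>
lemma isometry_vimage_lborel:
  fixes f :: "'v::euclidean_space \<Rightarrow> 'v"
  assumes f: "linear f" and ff: "\<And>x. f (f x) = x" and nf: "\<And>x. norm (f x) = norm x"
    and A: "A \<in> sets borel"
  shows "emeasure lborel (f -` A) = emeasure lborel A"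
proof -
  obtain c where c: "\<And>A. A \<in> sets borel \<Longrightarrow> emeasure lborel (f -` A) = c * emeasure lborel A"
    using linear_vimage_lborel[OF f f ff] by blast
  define b where "b = emeasure lborel (ball (0::'v) 1)"
  have "f -` ball 0 1 = ball 0 1" by (auto simp: nf)
  hence "c * b = b" using c[of "ball 0 1"] by (simp add: b_def)
  moreover have "b \<noteq> 0"
  proof
    assume "b = 0"
    hence "emeasure lborel (ball (0::'v) 1) = 0" by (simp add: b_def)
    hence "ball (0::'v) 1 \<in> null_sets (completion lborel)"
      by (intro null_sets_completionI) auto
    hence "negligible (ball (0::'v) 1)" by (simp add: negligible_iff_null_sets)
    moreover have "\<not> negligible (ball (0::'v) 1)" by (intro open_not_negligible) auto
    ultimately show False by simp
  qed
  moreover have "b < \<infinity>" using emeasure_lborel_ball_finite by (simp add: b_def)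
  ultimately have "c = 1"
    by (metis ennreal_divide_self ennreal_mult_divide_eq infinity_ennreal_def less_irrefl top.not_eq_extremum)
  thus ?thesis using c[OF A] by simp
qed

section \<open>Hyperbolic volume as the measure of a cone\<close>

lemma nn_integral_power_Icc:
  assumes "b \<ge> 0"
  shows "(\<integral>\<^sup>+x. ennreal (x ^ n) * indicator {0..b} x \<partial>lborel) = ennreal (b ^ Suc n / real (Suc n))"
proof -
  have "(\<integral>\<^sup>+x. ennreal (x ^ n) * indicator {0..b} x \<partial>lborel)
      = ennreal (b ^ Suc n / real (Suc n) - 0 ^ Suc n / real (Suc n))"
    using assms
    by (intro nn_integral_FTC_Icc[where F = "\<lambda>x. x ^ Suc n / real (Suc n)"])
       (auto intro!: derivative_eq_intros simp del: power_Suc of_nat_Suc)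
  thus ?thesis by simp
qed

text \<open>
  The density \<open>(1 - |x|\<^sup>2) powr (- (n + 1) / 2)\<close> is \<open>n + 1\<close> times the integral of \<open>l ^ n\<close>
  over \<open>0 \<le> l \<le> (1 - |x|\<^sup>2) powr (- 1 / 2)\<close>, and \<open>l ^ n\<close> is the Jacobian of \<open>x \<mapsto> l *\<^sub>R x\<close>.
  So the volume of \<open>S\<close> is measured by the part of the cone over \<open>S\<close> on which the Minkowski
  form is at most 1, and it becomes accessible to linear changes of coordinates.
\<close>
lemma emeasure_hyp_measure_cone:
  fixes S :: "'a::euclidean_space set"
  assumes [measurable]: "S \<in> sets borel" and S: "S \<subseteq> ball 0 1"
  shows "emeasure hyp_measure S = ennreal (real DIM('a) + 1) *
    emeasure lborel {z :: real \<times> 'a. 0 < fst z \<and> inverse (fst z) *\<^sub>R snd z \<in> S \<and>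
                                   (fst z)\<^sup>2 - (norm (snd z))\<^sup>2 \<le> 1}"
    (is "_ = _ * emeasure lborel ?K")
proof -
  let ?n = "DIM('a)"
  define \<rho> where "\<rho> = (\<lambda>x::'a. (1 - (norm x)\<^sup>2) powr (- (real ?n + 1) / 2))"
  have [measurable]: "\<rho> \<in> borel_measurable borel" unfolding \<rho>_def by measurable
  have K[measurable]: "?K \<in> sets borel"
  proof -
    have "{z \<in> space (borel :: (real \<times> 'a) measure). 0 < fst z \<and> inverse (fst z) *\<^sub>R snd z \<in> S \<and>
                                   (fst z)\<^sup>2 - (norm (snd z))\<^sup>2 \<le> 1} \<in> sets borel"
      unfolding borel_prod[symmetric] by measurable
    thus ?thesis by simp
  qed
  have fib: "(\<integral>\<^sup>+l. ennreal (l ^ ?n) * indicator {0..(1 - (norm x)\<^sup>2) powr (-1/2)} l \<partial>lborel)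
      = ennreal (\<rho> x / (real ?n + 1))" if "x \<in> S" for x
  proof -
    have x: "1 - (norm x)\<^sup>2 > 0" using that S by (auto simp: abs_square_less_1)
    have "((1 - (norm x)\<^sup>2) powr (-1/2)) ^ Suc ?n = \<rho> x"
    proof -
      have "((1 - (norm x)\<^sup>2) powr (-1/2)) ^ Suc ?n
          = ((1 - (norm x)\<^sup>2) powr (-1/2)) powr real (Suc ?n)"
        using x by (subst powr_realpow) auto
      also have "\<dots> = \<rho> x"
      proof -
        have "(-1/2) * real (Suc ?n) = - (real ?n + 1) / 2" by (simp add: field_simps)
        thus ?thesis unfolding \<rho>_def powr_powr by (simp only:)
      qed
      finally show ?thesis .
    qed
    thus ?thesis using nn_integral_power_Icc[of "(1 - (norm x)\<^sup>2) powr (-1/2)" ?n]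
      by (simp add: add.commute)
  qed
  have cut: "l \<le> (1 - (norm x)\<^sup>2) powr (-1/2) \<longleftrightarrow> l\<^sup>2 - (norm (l *\<^sub>R x))\<^sup>2 \<le> 1"
    if "x \<in> S" "l > 0" for x l
  proof -
    have x: "1 - (norm x)\<^sup>2 > 0" using that S by (auto simp: abs_square_less_1)
    define s where "s = sqrt (1 - (norm x)\<^sup>2)"
    have s: "s > 0" "s\<^sup>2 = 1 - (norm x)\<^sup>2" using x by (auto simp: s_def)
    have "(1 - (norm x)\<^sup>2) powr (-1/2) = 1 / s"
      using x by (simp add: s_def powr_minus_divide powr_half_sqrt)
    hence "l \<le> (1 - (norm x)\<^sup>2) powr (-1/2) \<longleftrightarrow> l \<le> 1 / s"
      by (simp only:)
    also have "\<dots> \<longleftrightarrow> l * s \<le> 1"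
      using s by (simp add: pos_le_divide_eq)
    also have "\<dots> \<longleftrightarrow> (l * s)\<^sup>2 \<le> 1"
      using that s by (simp add: abs_square_le_1 abs_mult)
    also have "(l * s)\<^sup>2 = l\<^sup>2 - (norm (l *\<^sub>R x))\<^sup>2"
      unfolding power_mult_distrib s(2) by (simp add: power_mult_distrib algebra_simps)
    finally show ?thesis .
  qed
  have "emeasure lborel ?K = (\<integral>\<^sup>+z. indicator ?K z \<partial>(lborel \<Otimes>\<^sub>M lborel))"
    by (simp add: lborel_prod)
  also have "\<dots> = (\<integral>\<^sup>+l. \<integral>\<^sup>+y. indicator ?K (l, y) \<partial>lborel \<partial>lborel)"
    by (subst lborel.nn_integral_fst) (simp_all add: lborel_prod)
  also have "\<dots> = (\<integral>\<^sup>+l. \<integral>\<^sup>+x. indicator {0<..} l * ennreal (l ^ ?n) * indicator ?K (l, l *\<^sub>R x) \<partial>lborel \<partial>lborel)"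
  proof (rule nn_integral_cong)
    fix l :: real
    have mm: "(\<lambda>y. indicator ?K (l, y) :: ennreal) \<in> borel_measurable borel"
      by (rule measurable_compose[OF _ borel_measurable_indicator[OF K]])
         (simp add: borel_prod[symmetric])
    show "(\<integral>\<^sup>+y. indicator ?K (l, y) \<partial>lborel) = 
      (\<integral>\<^sup>+x. indicator {0<..} l * ennreal (l ^ ?n) * indicator ?K (l, l *\<^sub>R x) \<partial>lborel)"
    proof (cases "l > 0")
      case True
      have mm2: "(\<lambda>x. indicator ?K (l, l *\<^sub>R x) :: ennreal) \<in> borel_measurable borel"
        by (rule measurable_compose[OF _ mm]) measurable
      show ?thesis using True
        by (subst nn_integral_lborel_scale[OF mm True])
           (simp add: nn_integral_cmult mm2)
    qed simp
  qed
  also have "\<dots> = (\<integral>\<^sup>+x. \<integral>\<^sup>+l. indicator {0<..} l * ennreal (l ^ ?n) * indicator ?K (l, l *\<^sub>R x) \<partial>lborel \<partial>lborel)"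
  proof (rule lborel_pair.Fubini'[symmetric])
    have "(\<lambda>p. indicator ?K (fst p, fst p *\<^sub>R snd p) :: ennreal) \<in> borel_measurable (lborel \<Otimes>\<^sub>M lborel)"
      by (rule measurable_compose[OF _ borel_measurable_indicator[OF K]])
         (simp add: borel_prod[symmetric])
    thus "(\<lambda>(l, x). indicator {0<..} l * ennreal (l ^ ?n) * indicator ?K (l, l *\<^sub>R x))
      \<in> borel_measurable (lborel \<Otimes>\<^sub>M lborel)"
      unfolding case_prod_beta by measurable
  qed
  also have "\<dots> = (\<integral>\<^sup>+x. indicator S x * (\<integral>\<^sup>+l. ennreal (l ^ ?n) * indicator {0..(1 - (norm x)\<^sup>2) powr (-1/2)} l \<partial>lborel) \<partial>lborel)"
  proof (rule nn_integral_cong)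
    fix x :: 'a
    have "(\<integral>\<^sup>+l. indicator {0<..} l * ennreal (l ^ ?n) * indicator ?K (l, l *\<^sub>R x) \<partial>lborel)
       = (\<integral>\<^sup>+l. indicator S x * (ennreal (l ^ ?n) * indicator {0..(1 - (norm x)\<^sup>2) powr (-1/2)} l) \<partial>lborel)"
      \<comment> \<open>The cone omits its apex \<open>l = 0\<close>, which is a null set of parameters.\<close>
    proof (rule nn_integral_cong_AE, rule AE_mp[OF AE_lborel_singleton[of 0]], rule AE_I2, rule impI)
      fix l :: real assume "l \<noteq> 0"
      show "indicator {0<..} l * ennreal (l ^ ?n) * indicator ?K (l, l *\<^sub>R x)
        = indicator S x * (ennreal (l ^ ?n) * indicator {0..(1 - (norm x)\<^sup>2) powr (-1/2)} l)"
      proof (cases "l > 0 \<and> x \<in> S")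
        case True
        thus ?thesis using cut[of x l] by (simp add: indicator_def)
      next
        case False
        thus ?thesis using \<open>l \<noteq> 0\<close> by (auto simp: indicator_def)
      qed
    qed
    also have "\<dots> = indicator S x * (\<integral>\<^sup>+l. ennreal (l ^ ?n) * indicator {0..(1 - (norm x)\<^sup>2) powr (-1/2)} l \<partial>lborel)"
      by (rule nn_integral_cmult) measurable
    finally show "(\<integral>\<^sup>+l. indicator {0<..} l * ennreal (l ^ ?n) * indicator ?K (l, l *\<^sub>R x) \<partial>lborel) = \<dots>" .
  qed
  also have "\<dots> = (\<integral>\<^sup>+x. indicator S x * ennreal (\<rho> x / (real ?n + 1)) \<partial>lborel)"
  proof (rule nn_integral_cong)
    fix x :: 'a
    show "indicator S x * (\<integral>\<^sup>+l. ennreal (l ^ ?n) * indicator {0..(1 - (norm x)\<^sup>2) powr (-1/2)} l \<partial>lborel)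
        = indicator S x * ennreal (\<rho> x / (real ?n + 1))"
    proof (cases "x \<in> S")
      case True
      show ?thesis by (simp only: fib[OF True])
    next
      case False
      hence "indicator S x = (0::ennreal)" by simp
      thus ?thesis by (simp only: mult_zero_left)
    qed
  qed
  finally have "ennreal (real ?n + 1) * emeasure lborel ?K
    = (\<integral>\<^sup>+x. ennreal (real ?n + 1) * (indicator S x * ennreal (\<rho> x / (real ?n + 1))) \<partial>lborel)"
    by (simp add: nn_integral_cmult)
  also have "\<dots> = (\<integral>\<^sup>+x. ennreal (indicator (ball 0 1) x * \<rho> x) * indicator S x \<partial>lborel)"
  proof (rule nn_integral_cong)
    fix x
    have "ennreal (real ?n + 1) * ennreal (\<rho> x / (real ?n + 1)) = ennreal (\<rho> x)"
      by (subst ennreal_mult[symmetric]) (auto simp: \<rho>_def add_nonneg_eq_0_iff)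
    thus "ennreal (real ?n + 1) * (indicator S x * ennreal (\<rho> x / (real ?n + 1)))
      = ennreal (indicator (ball 0 1) x * \<rho> x) * indicator S x"
      using S by (cases "x \<in> S") auto
  qed
  also have "\<dots> = emeasure hyp_measure S"
  proof -
    have h: "hyp_measure = density lborel (\<lambda>x::'a. ennreal (indicator (ball 0 1) x * \<rho> x))"
      by (simp only: hyp_measure_def \<rho>_def)
    have [measurable]: "ball (0::'a) 1 \<in> sets borel" by simp
    have "(\<lambda>x. ennreal (indicator (ball 0 1) x * \<rho> x)) \<in> borel_measurable borel"
      by measurable
    thus ?thesis unfolding h by (subst emeasure_density) simp_all
  qed
  finally show ?thesis by simp
qed

section \<open>The measure of a horoball sector in normal coordinates\<close>

text \<open>
  The Minkowski form in coordinates with respect to light-like vectors whose pairwise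
  products are 1: it is the quadratic form of the matrix \<open>J - I\<close>.
\<close>
definition lorentz_form :: "'v::euclidean_space \<Rightarrow> real" where
  "lorentz_form z = (z \<bullet> One)\<^sup>2 - (norm z)\<^sup>2"

text \<open>
  The cone over the part of a simplex that lies in a horoball, in the coordinates just
  described: nonnegative coordinates describe the simplex, and the horoball at the vertex
  \<open>\<beta>\<close> is cut out by the product with that vertex, which is the sum of all coordinates except
  the one along \<open>\<beta>\<close>. The bound 1 on the form truncates the cone.
\<close>
definition cusp_region :: "'v::euclidean_space \<Rightarrow> real \<Rightarrow> 'v set" where
  "cusp_region \<beta> r = {z. (\<forall>b\<in>Basis. 0 \<le> z \<bullet> b) \<and> 0 < lorentz_form z \<and> lorentz_form z \<le> 1 \<and>
     (z \<bullet> One - z \<bullet> \<beta>)\<^sup>2 \<le> r\<^sup>2 * lorentz_form z}"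

lemma cusp_region_borel [measurable]: "cusp_region \<beta> r \<in> sets borel"
proof -
  have "{z \<in> space borel. (\<forall>b\<in>Basis. 0 \<le> z \<bullet> b) \<and> 0 < lorentz_form z \<and> lorentz_form z \<le> 1 \<and>
     (z \<bullet> One - z \<bullet> \<beta>)\<^sup>2 \<le> r\<^sup>2 * lorentz_form z} \<in> sets borel"
    unfolding lorentz_form_def by measurable
  thus ?thesis by (simp add: cusp_region_def)
qed

lemma inner_Basis_One: "b \<in> Basis \<Longrightarrow> b \<bullet> One = 1"
  by (simp add: inner_sum_right inner_Basis if_distrib cong: if_cong)

text \<open>
  The reflection in \<open>\<beta> - \<gamma>\<close> exchanges the two basis vectors and preserves everything else in
  the definition. This is the reason why the volume constants of the vertices of the simplex
  agree.
\<close>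
lemma emeasure_cusp_region_swap:
  fixes \<beta> \<gamma> :: "'v::euclidean_space"
  assumes \<beta>: "\<beta> \<in> Basis" and \<gamma>: "\<gamma> \<in> Basis"
  shows "emeasure lborel (cusp_region \<beta> r) = emeasure lborel (cusp_region \<gamma> r)"
proof (cases "\<beta> = \<gamma>")
  case False
  \<comment> \<open>As \<open>d \<bullet> d = 2\<close>, this \<open>R\<close> is the orthogonal reflection in the hyperplane orthogonal to \<open>d\<close>.\<close>
  define d where "d = \<beta> - \<gamma>"
  define R where "R = (\<lambda>z. z - (z \<bullet> d) *\<^sub>R d)"
  have db: "d \<bullet> b = (if b = \<beta> then 1 else if b = \<gamma> then -1 else 0)" if "b \<in> Basis" for b
    using that \<beta> \<gamma> False by (auto simp: d_def inner_diff_left inner_Basis)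
  have dd: "d \<bullet> d = 2"
    using \<beta> \<gamma> False by (simp add: d_def inner_diff_left inner_diff_right inner_Basis)
  have d1: "d \<bullet> One = 0"
    using \<beta> \<gamma> by (simp add: d_def inner_diff_left inner_Basis_One)
  have lin: "linear R"
    by (auto intro!: linearI simp: R_def inner_add_left algebra_simps)
  have RR: "R (R z) = z" for z
    by (simp add: R_def inner_diff_left dd)
  have nR: "norm (R z) = norm z" for z
    by (simp add: norm_eq_sqrt_inner R_def inner_diff_left inner_diff_right dd inner_commute)
  have R1: "R z \<bullet> One = z \<bullet> One" for z
    by (simp add: R_def inner_diff_left d1)
  have Rb: "R z \<bullet> b = z \<bullet> (if b = \<beta> then \<gamma> else if b = \<gamma> then \<beta> else b)" if "b \<in> Basis" for z b
    using that by (simp add: R_def inner_diff_left db) (simp add: d_def inner_diff_right)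
  have pos: "(\<forall>b\<in>Basis. 0 \<le> R z \<bullet> b) \<longleftrightarrow> (\<forall>b\<in>Basis. 0 \<le> z \<bullet> b)" for z
  proof -
    have *: "\<forall>b\<in>Basis. 0 \<le> R z \<bullet> b" if "\<forall>b\<in>Basis. 0 \<le> z \<bullet> b" for z
      using that \<beta> \<gamma> by (simp add: Rb)
    show ?thesis using *[of z] *[of "R z"] by (auto simp: RR)
  qed
  have R\<gamma>: "R z \<bullet> \<gamma> = z \<bullet> \<beta>" for z
    using \<gamma> False by (simp add: Rb)
  have "R -` cusp_region \<gamma> r = cusp_region \<beta> r"
    unfolding cusp_region_def lorentz_form_def vimage_def mem_Collect_eq pos nR R1 R\<gamma> ..
  thus ?thesis
    using isometry_vimage_lborel[OF lin RR nR cusp_region_borel, of \<gamma> r] by simp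
qed simp

lemma norm_One_sq: "(norm (One :: 'v::euclidean_space))\<^sup>2 = DIM('v)"
  by (simp add: power2_norm_eq_inner inner_sum_left inner_Basis_One)

lemma One_Pair: "(One :: 'a::euclidean_space \<times> 'b::euclidean_space) = (One, One)"
  by (simp add: sum_Basis_prod_eq prod_eq_iff fst_sum snd_sum)

text \<open>
  For fixed remaining coordinates \<open>y\<close> with sum \<open>S\<close>, the form is affine in the distinguished
  coordinate \<open>x\<close> with slope \<open>2 * S\<close>, so the fibre is the interval on which the form lies
  between \<open>S\<^sup>2 / r\<^sup>2\<close> and 1, of length \<open>(1 - S\<^sup>2 / r\<^sup>2) / (2 * S)\<close>. The bound on \<open>r\<close> is what
  makes \<open>x \<ge> 0\<close> automatic on it. Substituting \<open>r *\<^sub>R y\<close> for \<open>y\<close> turns the length into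
  \<open>1 / r\<close> times its value for \<open>r = 1\<close> and contributes a factor \<open>r ^ n\<close>.
\<close>
lemma emeasure_cusp_region:
  obtains C :: ennreal where
    "\<And>r. 0 < r \<Longrightarrow> r\<^sup>2 * (real DIM('a::euclidean_space) - 1) \<le> DIM('a) \<Longrightarrow>
       emeasure lborel (cusp_region ((1, 0) :: real \<times> 'a) r) = ennreal (r ^ (DIM('a) - 1)) * C"
proof -
  have dim: "DIM('a) \<ge> 1" by (simp add: Suc_le_eq)
  define g where "g = (\<lambda>r (y::'a). if (\<forall>b\<in>Basis. 0 \<le> y \<bullet> b) \<and> 0 < y \<bullet> One
     then ennreal ((1 - (y \<bullet> One)\<^sup>2 / r\<^sup>2) / (2 * (y \<bullet> One))) else 0)"
  have gm[measurable]: "g r \<in> borel_measurable borel" for r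
    unfolding g_def by measurable
  have "emeasure lborel (cusp_region ((1, 0) :: real \<times> 'a) r) = ennreal (r ^ (DIM('a) - 1)) * (\<integral>\<^sup>+y. g 1 y \<partial>lborel)"
    if r: "0 < r" "r\<^sup>2 * (real DIM('a) - 1) \<le> DIM('a)" for r
  proof -
    let ?Z = "cusp_region ((1, 0) :: real \<times> 'a) r"
    have Z: "?Z \<in> sets (lborel \<Otimes>\<^sub>M lborel)" unfolding lborel_prod by simp
    have fib: "(\<integral>\<^sup>+x. indicator ?Z (x, y) \<partial>lborel) = g r y" for y
    proof -
      define S where "S = y \<bullet> One"
      have One: "(x, y) \<bullet> One = x + S" for x :: real
        by (simp add: One_Pair S_def)
      have q: "lorentz_form (x, y) = 2 * x * S + S\<^sup>2 - (norm y)\<^sup>2" for x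
        unfolding lorentz_form_def One
        by (simp add: norm_Pair power2_sum)
      have inZ: "(x, y) \<in> ?Z \<longleftrightarrow> 0 \<le> x \<and> (\<forall>b\<in>Basis. 0 \<le> y \<bullet> b) \<and> 0 < lorentz_form (x, y) \<and>
          lorentz_form (x, y) \<le> 1 \<and> S\<^sup>2 \<le> r\<^sup>2 * lorentz_form (x, y)" for x
        unfolding cusp_region_def mem_Collect_eq One by (auto simp: Basis_prod_def)
      show ?thesis
      proof (cases "(\<forall>b\<in>Basis. 0 \<le> y \<bullet> b)")
        case False
        hence "(x, y) \<notin> ?Z" for x using inZ by blast
        thus ?thesis using False by (auto simp: g_def)
      next
        case True
        hence "S \<ge> 0" by (auto simp: S_def inner_sum_right intro!: sum_nonneg)
        show ?thesis
        proof (cases "S = 0")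
          case True
          \<comment> \<open>Then \<open>y = 0\<close>: this ray is the vertex itself, where the form vanishes.\<close>
          hence "(x, y) \<notin> ?Z" for x unfolding inZ q by auto
          thus ?thesis using True by (auto simp: g_def S_def)
        next
          case False
          with \<open>S \<ge> 0\<close> have S: "S > 0" by simp
          define lo hi where "lo = (S\<^sup>2 / r\<^sup>2 - S\<^sup>2 + (norm y)\<^sup>2) / (2 * S)"
            and "hi = (1 - S\<^sup>2 + (norm y)\<^sup>2) / (2 * S)"
          have "S\<^sup>2 \<le> DIM('a) * (norm y)\<^sup>2"
          proof -
            have "S \<le> norm y * norm (One :: 'a)" unfolding S_def by (rule norm_cauchy_schwarz)
            hence "S\<^sup>2 \<le> (norm y * norm (One :: 'a))\<^sup>2" using S by (intro power_mono) auto
            thus ?thesis unfolding power_mult_distrib norm_One_sq by (simp add: mult.commute)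
          qed
          moreover have "real DIM('a) * S\<^sup>2 - S\<^sup>2 \<le> real DIM('a) * (S\<^sup>2 / r\<^sup>2)"
          proof -
            have "S\<^sup>2 / r\<^sup>2 * (r\<^sup>2 * (real DIM('a) - 1)) = real DIM('a) * S\<^sup>2 - S\<^sup>2"
              using r(1) by (simp add: algebra_simps)
            moreover have "S\<^sup>2 / r\<^sup>2 * (r\<^sup>2 * (real DIM('a) - 1)) \<le> S\<^sup>2 / r\<^sup>2 * DIM('a)"
              by (intro mult_left_mono r(2)) simp
            ultimately show ?thesis by (simp add: mult.commute)
          qed
          ultimately have "real DIM('a) * (S\<^sup>2 - (norm y)\<^sup>2) \<le> real DIM('a) * (S\<^sup>2 / r\<^sup>2)"
            unfolding right_diff_distrib by linarith
          hence "S\<^sup>2 - (norm y)\<^sup>2 \<le> S\<^sup>2 / r\<^sup>2"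
            using dim by (simp only: mult_le_cancel_left_pos of_nat_0_less_iff DIM_positive)
          hence lo: "lo \<ge> 0" using S by (simp add: lo_def)
          have pos: "S\<^sup>2 / r\<^sup>2 > 0" using S r by simp
          have "(x, y) \<in> ?Z \<longleftrightarrow> x \<in> {lo..hi}" for x
          proof -
            have 1: "S\<^sup>2 \<le> r\<^sup>2 * v \<longleftrightarrow> S\<^sup>2 / r\<^sup>2 \<le> v" for v
              using r by (simp add: pos_divide_le_eq mult.commute)
            have 2: "lo \<le> x \<longleftrightarrow> S\<^sup>2 / r\<^sup>2 \<le> lorentz_form (x, y)"
              using S unfolding lo_def q by (simp add: pos_divide_le_eq) linarith
            have 3: "x \<le> hi \<longleftrightarrow> lorentz_form (x, y) \<le> 1"
              using S unfolding hi_def q by (simp add: pos_le_divide_eq) linarith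
            show ?thesis unfolding inZ 1 using lo pos 2 3 True by auto
          qed
          hence "(\<integral>\<^sup>+x. indicator ?Z (x, y) \<partial>lborel) = (\<integral>\<^sup>+x. indicator {lo..hi} x \<partial>lborel)"
            by (simp add: indicator_def)
          also have "\<dots> = ennreal (hi - lo)"
            by (simp add: emeasure_lborel_Icc_eq ennreal_neg)
          also have "hi - lo = (1 - S\<^sup>2 / r\<^sup>2) / (2 * S)"
            by (simp add: hi_def lo_def diff_divide_distrib[symmetric])
          finally show ?thesis using S True by (simp add: g_def S_def)
        qed
      qed
    qed
    have gs: "g r (r *\<^sub>R y) = ennreal (1 / r) * g 1 y" for y
    proof -
      have "(1 - (r * (y \<bullet> One))\<^sup>2 / r\<^sup>2) / (2 * (r * (y \<bullet> One))) = 1 / r * ((1 - (y \<bullet> One)\<^sup>2) / (2 * (y \<bullet> One)))"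
        using r by (simp add: power_mult_distrib)
      thus ?thesis using r
        by (auto simp: g_def zero_le_mult_iff zero_less_mult_iff ennreal_mult'[symmetric] simp del: inner_sum_right)
    qed
    have "emeasure lborel ?Z = (\<integral>\<^sup>+z. indicator ?Z z \<partial>(lborel \<Otimes>\<^sub>M lborel))"
      by (simp add: lborel_prod)
    also have "\<dots> = (\<integral>\<^sup>+y. \<integral>\<^sup>+x. indicator ?Z (x, y) \<partial>lborel \<partial>lborel)"
      using Z by (subst lborel_pair.nn_integral_snd) simp_all
    also have "\<dots> = (\<integral>\<^sup>+y. g r y \<partial>lborel)" by (simp add: fib)
    also have "\<dots> = ennreal (r ^ DIM('a)) * (\<integral>\<^sup>+y. g r (r *\<^sub>R y) \<partial>lborel)"
      using r by (intro nn_integral_lborel_scale) auto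
    also have "\<dots> = ennreal (r ^ DIM('a)) * ennreal (1 / r) * (\<integral>\<^sup>+y. g 1 y \<partial>lborel)"
      by (simp add: gs nn_integral_cmult mult.assoc)
    also have "ennreal (r ^ DIM('a)) * ennreal (1 / r) = ennreal (r ^ (DIM('a) - 1))"
      using r dim by (subst ennreal_mult[symmetric]) (auto simp: power_diff)
    finally show ?thesis .
  qed
  thus ?thesis using that by blast
qed

section \<open>Symmetries of a regular ideal simplex\<close>

lemma hyperbolic_cosine_ge_1:
  fixes x y :: "'a::real_inner"
  assumes "norm x < 1" "norm y < 1"
  shows "1 \<le> (1 - x \<bullet> y) / (sqrt (1 - (norm x)\<^sup>2) * sqrt (1 - (norm y)\<^sup>2))"
proof -
  define a b where "a = norm x" and "b = norm y"
  have ab: "0 \<le> a" "a < 1" "0 \<le> b" "b < 1" using assms by (auto simp: a_def b_def)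
  have pos: "0 < 1 - a\<^sup>2" "0 < 1 - b\<^sup>2" using ab by (auto simp: abs_square_less_1)
  have "a * b \<le> 1" using ab by (simp add: mult_le_one)
  have "(1 - a\<^sup>2) * (1 - b\<^sup>2) \<le> (1 - a * b)\<^sup>2"
    using zero_le_power2[of "a - b"] by (simp add: power2_eq_square algebra_simps)
  hence "sqrt ((1 - a\<^sup>2) * (1 - b\<^sup>2)) \<le> 1 - a * b"
    using \<open>a * b \<le> 1\<close> by (intro real_le_lsqrt) auto
  also have "\<dots> \<le> 1 - x \<bullet> y" using norm_cauchy_schwarz[of x y] by (simp add: a_def b_def)
  finally have "sqrt (1 - a\<^sup>2) * sqrt (1 - b\<^sup>2) \<le> 1 - x \<bullet> y" by (simp add: real_sqrt_mult)
  moreover have "0 < sqrt (1 - a\<^sup>2) * sqrt (1 - b\<^sup>2)" using pos by simp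
  ultimately show ?thesis by (simp add: a_def b_def)
qed

text \<open>
  In the open ball the factor of \<open>x\<close> is \<open>sqrt (1 - |f x|\<^sup>2) / sqrt (1 - |x|\<^sup>2)\<close>, because
  distances determine hyperbolic cosines. This quotient makes no sense on the boundary, but
  pairing with the origin expresses it as \<open>(1 - f x \<bullet> f 0) / \<omega> 0\<close>, which is continuous and
  positive on the closed ball; the identity then extends by continuity in one variable after
  the other.
\<close>
lemma hyp_isometry_conformal_factor:
  fixes f :: "'a::euclidean_space \<Rightarrow> 'a"
  assumes f: "hyp_isometry f"
  obtains W where "\<And>x. x \<in> cball 0 1 \<Longrightarrow> W x > 0"
    "\<And>x y. x \<in> cball 0 1 \<Longrightarrow> y \<in> cball 0 1 \<Longrightarrow> 1 - f x \<bullet> f y = W x * W y * (1 - x \<bullet> y)"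
proof -
  have cont: "continuous_on (cball 0 1) f" and bij: "bij_betw f (ball 0 1) (ball 0 1)"
    and iso: "\<And>x y. x \<in> ball 0 1 \<Longrightarrow> y \<in> ball 0 1 \<Longrightarrow> hdist (f x) (f y) = hdist x y"
    using f by (auto simp: hyp_isometry_def)
  have fb: "norm (f x) < 1" if "norm x < 1" for x
    using bij that by (auto simp: bij_betw_def)
  have fcb: "norm (f x) \<le> 1" if "x \<in> cball 0 1" for x
    by (rule continuous_on_closure_norm_le[of "ball 0 1"])
       (use that cont fb in \<open>auto intro: order_less_imp_le\<close>)
  define s where "s = (\<lambda>x::'a. sqrt (1 - (norm x)\<^sup>2))"
  have s: "s x > 0" if "norm x < 1" for x using that by (simp add: s_def abs_square_less_1)
  have s0: "s 0 = 1" by (simp add: s_def)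
  define \<omega> where "\<omega> = (\<lambda>x. s (f x) / s x)"
  have \<omega>: "\<omega> x > 0" if "norm x < 1" for x using s that fb by (simp add: \<omega>_def)
  have ball: "1 - f x \<bullet> f y = \<omega> x * \<omega> y * (1 - x \<bullet> y)" if "norm x < 1" "norm y < 1" for x y
  proof -
    have "hdist (f x) (f y) = hdist x y" using iso that by auto
    hence "arcosh ((1 - f x \<bullet> f y) / (s (f x) * s (f y))) = arcosh ((1 - x \<bullet> y) / (s x * s y))"
      by (simp add: hdist_def s_def)
    hence "(1 - f x \<bullet> f y) / (s (f x) * s (f y)) = (1 - x \<bullet> y) / (s x * s y)"
      using hyperbolic_cosine_ge_1[OF that] hyperbolic_cosine_ge_1[OF fb fb, OF that]
      unfolding s_def by (metis cosh_arcosh_real)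
    thus ?thesis using s[OF that(1)] s[OF that(2)] s[OF fb[OF that(1)]] s[OF fb[OF that(2)]]
      by (simp add: \<omega>_def field_simps)
  qed
  define W where "W = (\<lambda>x. (1 - f x \<bullet> f 0) / \<omega> 0)"
  have W\<omega>: "W x = \<omega> x" if "norm x < 1" for x
    using ball[OF that, of 0] \<omega>[of 0] by (simp add: W_def)
  have contW: "continuous_on (cball 0 1) W"
    unfolding W_def using \<omega>[of 0] by (auto intro!: continuous_intros cont)
  have Wpos: "W x > 0" if "x \<in> cball 0 1" for x
  proof -
    have "f x \<bullet> f 0 \<le> norm (f x) * norm (f 0)" by (rule norm_cauchy_schwarz)
    also have "\<dots> \<le> 1 * norm (f 0)" using fcb[OF that] by (intro mult_right_mono) auto
    also have "\<dots> < 1" using fb[of 0] by simp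
    finally show ?thesis using \<omega>[of 0] by (simp add: W_def)
  qed
  have 1: "1 - f x \<bullet> f y - W x * W y * (1 - x \<bullet> y) = 0" if "x \<in> cball 0 1" "norm y < 1" for x y
  proof (rule continuous_constant_on_closure[of "ball 0 1" "\<lambda>x. 1 - f x \<bullet> f y - W x * W y * (1 - x \<bullet> y)"])
    show "continuous_on (closure (ball 0 1)) (\<lambda>x. 1 - f x \<bullet> f y - W x * W y * (1 - x \<bullet> y))"
      by (auto intro!: continuous_intros cont contW)
    show "\<And>x. x \<in> ball 0 1 \<Longrightarrow> 1 - f x \<bullet> f y - W x * W y * (1 - x \<bullet> y) = 0"
      using ball that by (simp add: W\<omega>)
    show "x \<in> closure (ball 0 1)" using that by simp
  qed
  have 2: "1 - f x \<bullet> f y - W x * W y * (1 - x \<bullet> y) = 0" if "x \<in> cball 0 1" "y \<in> cball 0 1" for x y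
  proof (rule continuous_constant_on_closure[of "ball 0 1" "\<lambda>y. 1 - f x \<bullet> f y - W x * W y * (1 - x \<bullet> y)"])
    show "continuous_on (closure (ball 0 1)) (\<lambda>y. 1 - f x \<bullet> f y - W x * W y * (1 - x \<bullet> y))"
      by (auto intro!: continuous_intros cont contW)
    show "\<And>y. y \<in> ball 0 1 \<Longrightarrow> 1 - f x \<bullet> f y - W x * W y * (1 - x \<bullet> y) = 0"
      using 1 that by simp
    show "y \<in> closure (ball 0 1)" using that by simp
  qed
  show ?thesis using that[of W] Wpos 2 by simp
qed

text \<open>
  A unit vector cannot be a proper convex combination of unit vectors, as the ball is
  strictly convex.
\<close>
lemma unit_vector_in_hull:
  fixes V :: "'a::euclidean_space set"
  assumes "finite V" and V: "\<And>v. v \<in> V \<Longrightarrow> norm v = 1" and x: "x \<in> convex hull V" "norm x = 1"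
  shows "x \<in> V"
proof -
  obtain u where u: "\<And>v. v \<in> V \<Longrightarrow> 0 \<le> u v" "sum u V = 1" "(\<Sum>v\<in>V. u v *\<^sub>R v) = x"
    using x(1) assms(1) by (auto simp: convex_hull_finite)
  have xx: "x \<bullet> x = 1" using x(2) by (simp add: norm_eq_1)
  have le: "v \<bullet> x \<le> 1" if "v \<in> V" for v
    using norm_cauchy_schwarz[of v x] V[OF that] x(2) by simp
  have "(\<Sum>v\<in>V. u v * (1 - v \<bullet> x)) = sum u V - (\<Sum>v\<in>V. u v *\<^sub>R v) \<bullet> x"
    by (simp add: inner_sum_left right_diff_distrib sum_subtractf)
  also have "\<dots> = 0" using u xx by simp
  finally have z: "\<forall>v\<in>V. u v * (1 - v \<bullet> x) = 0"
    using assms(1) u(1) le by (subst (asm) sum_nonneg_eq_0_iff) auto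
  obtain v where v: "v \<in> V" "u v \<noteq> 0"
    using u(2) by (metis sum.neutral zero_neq_one)
  hence "v \<bullet> x = 1" using z by auto
  hence "(norm (v - x))\<^sup>2 = 0"
    using V[OF v(1)] xx unfolding power2_norm_eq_inner
    by (simp add: inner_diff_left inner_diff_right inner_commute norm_eq_1)
  thus ?thesis using v by simp
qed

text \<open>
  The vertices are the only points of the simplex on the unit sphere, and by the conformal
  identity a symmetry maps the sphere to itself injectively.
\<close>
lemma symmetry_permutes_vertices:
  fixes E :: "nat \<Rightarrow> 'a::euclidean_space"
  assumes E: "ideal_simplex E" and f: "simplex_symmetry E f"
  obtains \<pi> c where "bij_betw \<pi> {..DIM('a)} {..DIM('a)}"
    "\<And>i. i \<le> DIM('a) \<Longrightarrow> f (E i) = E (\<pi> i)"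
    "\<And>i. i \<le> DIM('a) \<Longrightarrow> c i > 0"
    "\<And>i j. i \<le> DIM('a) \<Longrightarrow> j \<le> DIM('a) \<Longrightarrow>
        1 - E (\<pi> i) \<bullet> E (\<pi> j) = c i * c j * (1 - E i \<bullet> E j)"
proof -
  let ?N = "{..DIM('a)}"
  have unit: "\<And>i. i \<le> DIM('a) \<Longrightarrow> norm (E i) = 1" and inj: "inj_on E ?N"
    using E by (auto simp: ideal_simplex_def)
  obtain W where W: "\<And>x. x \<in> cball 0 1 \<Longrightarrow> W x > 0"
    "\<And>x y. x \<in> cball 0 1 \<Longrightarrow> y \<in> cball 0 1 \<Longrightarrow> 1 - f x \<bullet> f y = W x * W y * (1 - x \<bullet> y)"
    using hyp_isometry_conformal_factor f by (metis simplex_symmetry_def)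
  have cb: "E i \<in> cball 0 1" if "i \<le> DIM('a)" for i using unit[OF that] by simp
  have fE: "f (E i) \<in> E ` ?N" if i: "i \<le> DIM('a)" for i
  proof (rule unit_vector_in_hull)
    have "f (E i) \<bullet> f (E i) = 1" using W(2)[OF cb cb, OF i i] unit[OF i] by (simp add: norm_eq_1)
    thus "norm (f (E i)) = 1" by (simp add: norm_eq_1)
    have "E i \<in> simplex_of E" using i by (auto simp: simplex_of_def face_def intro: hull_inc)
    hence "f (E i) \<in> simplex_of E" using f by (auto simp: simplex_symmetry_def)
    thus "f (E i) \<in> convex hull (E ` ?N)" by (simp add: simplex_of_def face_def)
  qed (auto simp: unit)
  have "\<forall>i\<in>?N. \<exists>k\<in>?N. f (E i) = E k" using fE by blast
  then obtain \<pi> where "\<forall>i\<in>?N. \<pi> i \<in> ?N \<and> f (E i) = E (\<pi> i)" using bchoice by metis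
  hence \<pi>: "f (E i) = E (\<pi> i)" "\<pi> i \<in> ?N" if "i \<le> DIM('a)" for i using that by auto
  have "inj_on \<pi> ?N"
  proof (rule inj_onI)
    fix i j assume ij: "i \<in> ?N" "j \<in> ?N" "\<pi> i = \<pi> j"
    hence "f (E i) \<bullet> f (E j) = 1" using \<pi>[of i] \<pi>[of j] unit[of "\<pi> j"] by (simp add: norm_eq_1)
    hence "E i \<bullet> E j = 1" using W(2)[of "E i" "E j"] W(1)[of "E i"] W(1)[of "E j"] cb ij by simp
    hence "(norm (E i - E j))\<^sup>2 = 0"
      using unit[of i] unit[of j] ij unfolding power2_norm_eq_inner
      by (simp add: inner_diff_left inner_diff_right inner_commute norm_eq_1)
    thus "i = j" using inj ij by (simp add: inj_on_def)
  qed
  hence "bij_betw \<pi> ?N ?N"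
    using endo_inj_surj[of ?N \<pi>] \<pi>(2) unfolding bij_betw_def by auto
  moreover have "1 - E (\<pi> i) \<bullet> E (\<pi> j) = W (E i) * W (E j) * (1 - E i \<bullet> E j)"
    if "i \<le> DIM('a)" "j \<le> DIM('a)" for i j
    using W(2)[OF cb cb, OF that] \<pi>(1) that by simp
  ultimately show ?thesis using that[of \<pi> "W \<circ> E"] \<pi>(1) W(1) cb by simp
qed

text \<open>
  If the symmetries preserved \<open>g\<close> itself, transitivity on pairs would make it constant at
  once. They only preserve it up to factors \<open>c a * c b\<close>, so a canonical rescaling is used:
  the row products \<open>P a\<close> pick up \<open>c a ^ (n - 1) * \<Lambda>\<close> with \<open>\<Lambda>\<close> the product of all factors,
  and comparing the product of all rows before and after the permutation gives \<open>\<Lambda> = 1\<close>.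
  Dividing by the \<open>(n - 1)\<close>-st roots of the row products therefore yields invariant weights.
\<close>
lemma gauge_of_pair_transitive_weights:
  fixes g :: "nat \<Rightarrow> nat \<Rightarrow> real"
  assumes n: "n \<ge> 2"
    and pos: "\<And>i j. i \<le> n \<Longrightarrow> j \<le> n \<Longrightarrow> i \<noteq> j \<Longrightarrow> g i j > 0"
    and sym: "\<And>i j. g i j = g j i"
    and trans: "\<And>i j k l. i \<le> n \<Longrightarrow> j \<le> n \<Longrightarrow> i \<noteq> j \<Longrightarrow> k \<le> n \<Longrightarrow> l \<le> n \<Longrightarrow> k \<noteq> l \<Longrightarrow>
      \<exists>\<pi> c. bij_betw \<pi> {..n} {..n} \<and> {\<pi> i, \<pi> j} = {k, l} \<and> (\<forall>a\<le>n. c a > 0) \<and>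
        (\<forall>a\<le>n. \<forall>b\<le>n. g (\<pi> a) (\<pi> b) = c a * c b * g a b)"
  obtains t where "\<And>i. i \<le> n \<Longrightarrow> t i > (0::real)"
    "\<And>i j. i \<le> n \<Longrightarrow> j \<le> n \<Longrightarrow> i \<noteq> j \<Longrightarrow> t i * t j * g i j = 1"
proof -
  let ?N = "{..n}"
  define P where "P = (\<lambda>i. \<Prod>j\<in>?N - {i}. g i j)"
  have Ppos: "P i > 0" if "i \<le> n" for i
    unfolding P_def using that by (intro prod_pos) (auto intro: pos)
  define \<tau> where "\<tau> = (\<lambda>i. inverse (root (n - 1) (P i)))"
  have \<tau>pos: "\<tau> i > 0" if "i \<le> n" for i using Ppos[OF that] n by (simp add: \<tau>_def)
  define h where "h = (\<lambda>i j. \<tau> i * \<tau> j * g i j)"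
  have h: "h k l = h i j" if ij: "i \<le> n" "j \<le> n" "i \<noteq> j" and kl: "k \<le> n" "l \<le> n" "k \<noteq> l" for i j k l
  proof -
    obtain \<pi> c where bij: "bij_betw \<pi> ?N ?N" and \<pi>: "{\<pi> i, \<pi> j} = {k, l}"
      and c: "\<And>a. a \<le> n \<Longrightarrow> c a > 0"
      and gc: "\<And>a b. a \<le> n \<Longrightarrow> b \<le> n \<Longrightarrow> g (\<pi> a) (\<pi> b) = c a * c b * g a b"
      using trans[OF ij kl] by blast
    define \<Lambda> where "\<Lambda> = prod c ?N"
    have \<Lambda>: "\<Lambda> > 0" unfolding \<Lambda>_def using c by (intro prod_pos) auto
    have P\<pi>: "P (\<pi> a) = c a ^ (n - 1) * \<Lambda> * P a" if a: "a \<le> n" for a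
    proof -
      have bij': "bij_betw \<pi> (?N - {a}) (?N - {\<pi> a})"
        using bij a by (intro bij_betw_DiffI) (auto simp: bij_betw_def)
      have "P (\<pi> a) = (\<Prod>b\<in>?N - {a}. g (\<pi> a) (\<pi> b))"
        unfolding P_def by (rule prod.reindex_bij_betw[OF bij', symmetric])
      also have "\<dots> = (\<Prod>b\<in>?N - {a}. c a * c b * g a b)"
        using a by (intro prod.cong) (auto simp: gc)
      also have "\<dots> = c a ^ card (?N - {a}) * prod c (?N - {a}) * P a"
        by (simp add: prod.distrib P_def)
      also have "card (?N - {a}) = Suc (n - 1)" using a n by simp
      also have "c a ^ Suc (n - 1) * prod c (?N - {a}) = c a ^ (n - 1) * \<Lambda>"
        unfolding \<Lambda>_def using a by (subst prod.remove[of ?N a]) auto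
      finally show ?thesis .
    qed
    have "prod P ?N = (\<Prod>a\<in>?N. P (\<pi> a))" by (rule prod.reindex_bij_betw[OF bij, symmetric])
    also have "\<dots> = (\<Prod>a\<in>?N. c a ^ (n - 1) * \<Lambda> * P a)" by (intro prod.cong) (auto simp: P\<pi>)
    also have "\<dots> = \<Lambda> ^ (n - 1) * \<Lambda> ^ Suc n * prod P ?N"
      by (simp add: prod.distrib \<Lambda>_def prod_power_distrib)
    finally have "\<Lambda> ^ (n - 1 + Suc n) * prod P ?N = prod P ?N" by (simp only: power_add)
    moreover have "prod P ?N > 0" using Ppos by (intro prod_pos) auto
    ultimately have "\<Lambda> ^ (n - 1 + Suc n) = 1" by (simp only: mult_cancel_right2) linarith
    hence "\<Lambda> ^ (n - 1 + Suc n) = 1 ^ (n - 1 + Suc n)" by (simp only: power_one)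
    hence "\<Lambda> = 1" using \<Lambda> by (intro power_eq_imp_eq_base[of \<Lambda> _ 1]) auto
    have \<tau>\<pi>: "\<tau> (\<pi> a) * c a = \<tau> a" if a: "a \<le> n" for a
    proof -
      have "root (n - 1) (c a ^ (n - 1)) = c a"
        using n c[OF a] by (intro real_root_pos2) auto
      hence "root (n - 1) (P (\<pi> a)) = c a * root (n - 1) (P a)"
        using n by (simp add: P\<pi>[OF a] \<open>\<Lambda> = 1\<close> real_root_mult)
      thus ?thesis using c[OF a] by (simp add: \<tau>_def)
    qed
    have "h (\<pi> i) (\<pi> j) = (\<tau> (\<pi> i) * c i) * (\<tau> (\<pi> j) * c j) * g i j"
      using ij by (simp add: h_def gc)
    also have "\<dots> = h i j" using ij by (simp only: \<tau>\<pi> h_def)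
    finally have "h (\<pi> i) (\<pi> j) = h i j" .
    moreover have "h (\<pi> j) (\<pi> i) = h (\<pi> i) (\<pi> j)"
      using sym[of "\<pi> i" "\<pi> j"] by (simp add: h_def)
    hence "h k l = h (\<pi> i) (\<pi> j)"
      using \<pi> unfolding doubleton_eq_iff by (elim disjE conjE) simp_all
    ultimately show ?thesis by simp
  qed
  define \<kappa> where "\<kappa> = h 0 1"
  have \<kappa>: "\<kappa> > 0" using \<tau>pos[of 0] \<tau>pos[of 1] pos[of 0 1] n by (simp add: \<kappa>_def h_def)
  show ?thesis
  proof (rule that[of "\<lambda>i. \<tau> i / sqrt \<kappa>"])
    show "\<tau> i / sqrt \<kappa> > 0" if "i \<le> n" for i using \<tau>pos[OF that] \<kappa> by simp
    fix i j assume "i \<le> n" "j \<le> n" "i \<noteq> j"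
    hence "h i j = \<kappa>" unfolding \<kappa>_def using n by (intro h) auto
    hence "\<tau> i * \<tau> j * g i j = \<kappa>" by (simp add: h_def)
    moreover have "\<tau> i / sqrt \<kappa> * (\<tau> j / sqrt \<kappa>) * g i j = (\<tau> i * \<tau> j * g i j) / (sqrt \<kappa> * sqrt \<kappa>)"
      by simp
    ultimately show "\<tau> i / sqrt \<kappa> * (\<tau> j / sqrt \<kappa>) * g i j = 1" using \<kappa> by simp
  qed
qed

text \<open>
  An edge determines its two vertices as its points on the unit sphere, so transitivity on
  edges provides the permutations that \<open>gauge_of_pair_transitive_weights\<close> asks for.
\<close>
lemma regular_ideal_simplex_gauge:
  fixes E :: "nat \<Rightarrow> 'a::euclidean_space"
  assumes dim: "DIM('a) \<ge> 2" and reg: "regular_ideal_simplex E"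
  obtains t where "\<And>i. i \<le> DIM('a) \<Longrightarrow> t i > (0::real)"
    "\<And>i j. i \<le> DIM('a) \<Longrightarrow> j \<le> DIM('a) \<Longrightarrow> i \<noteq> j \<Longrightarrow> t i * t j * (1 - E i \<bullet> E j) = 1"
proof -
  let ?n = "DIM('a)"
  have E: "ideal_simplex E" using reg by (simp add: regular_ideal_simplex_def)
  have unit: "\<And>i. i \<le> ?n \<Longrightarrow> norm (E i) = 1" and inj: "inj_on E {..?n}"
    using E by (auto simp: ideal_simplex_def)
  show ?thesis
  proof (rule gauge_of_pair_transitive_weights[of ?n "\<lambda>i j. 1 - E i \<bullet> E j"])
    show "0 < 1 - E i \<bullet> E j" if ij: "i \<le> ?n" "j \<le> ?n" "i \<noteq> j" for i j
    proof -
      have "E i \<noteq> E j" using inj ij by (auto simp: inj_on_def)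
      hence "0 < (norm (E i - E j))\<^sup>2" by simp
      also have "\<dots> = 2 * (1 - E i \<bullet> E j)"
        using unit[OF ij(1)] unit[OF ij(2)] unfolding power2_norm_eq_inner
        by (simp add: inner_diff_left inner_diff_right inner_commute norm_eq_1)
      finally show ?thesis by simp
    qed
    show "1 - E i \<bullet> E j = 1 - E j \<bullet> E i" for i j by (simp add: inner_commute)
    fix i j k l assume ij: "i \<le> ?n" "j \<le> ?n" "i \<noteq> j" and kl: "k \<le> ?n" "l \<le> ?n" "k \<noteq> l"
    have card: "card {i, j} = 1 + 1" "card {k, l} = 1 + 1" using ij kl by auto
    have "1 < ?n" using dim by simp
    hence "\<exists>f. simplex_symmetry E f \<and> f ` face E I = face E J"
      if "I \<subseteq> {..?n}" "card I = 1 + 1" "J \<subseteq> {..?n}" "card J = 1 + 1" for I J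
      using reg that unfolding regular_ideal_simplex_def by blast
    from this[of "{i, j}" "{k, l}"] have "\<exists>f. simplex_symmetry E f \<and> f ` face E {i, j} = face E {k, l}"
      using card ij kl by simp
    then obtain f where f: "simplex_symmetry E f" "f ` face E {i, j} = face E {k, l}" by blast
    obtain \<pi> c where \<pi>: "bij_betw \<pi> {..?n} {..?n}" "\<And>i. i \<le> ?n \<Longrightarrow> f (E i) = E (\<pi> i)"
      "\<And>i. i \<le> ?n \<Longrightarrow> c i > 0"
      "\<And>i j. i \<le> ?n \<Longrightarrow> j \<le> ?n \<Longrightarrow> 1 - E (\<pi> i) \<bullet> E (\<pi> j) = c i * c j * (1 - E i \<bullet> E j)"
      using symmetry_permutes_vertices[OF E f(1)] by metis
    have \<pi>N: "\<pi> a \<le> ?n" if "a \<le> ?n" for a using \<pi>(1) that by (auto simp: bij_betw_def)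
    have mem: "\<pi> a \<in> {k, l}" if a: "a \<in> {i, j}" for a
    proof -
      have an: "a \<le> ?n" using a ij by auto
      have "E a \<in> face E {i, j}" using a by (auto simp: face_def intro: hull_inc)
      hence "E (\<pi> a) \<in> face E {k, l}" unfolding \<pi>(2)[OF an, symmetric] f(2)[symmetric] by (rule imageI)
      hence "E (\<pi> a) \<in> convex hull (E ` {k, l})" by (simp only: face_def)
      hence "E (\<pi> a) \<in> E ` {k, l}"
        by (rule unit_vector_in_hull[rotated 2]) (use kl unit[OF \<pi>N[OF an]] unit in auto)
      then obtain m where m: "m \<in> {k, l}" "E (\<pi> a) = E m" by blast
      hence "\<pi> a = m" using inj_onD[OF inj, of "\<pi> a" m] \<pi>N[OF an] kl by auto
      thus ?thesis using m by simp
    qed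
    have "\<pi> i \<noteq> \<pi> j" using \<pi>(1) ij by (auto simp: bij_betw_def inj_on_def)
    hence "{\<pi> i, \<pi> j} = {k, l}" using mem[of i] mem[of j] by auto
    thus "\<exists>\<pi> c. bij_betw \<pi> {..?n} {..?n} \<and> {\<pi> i, \<pi> j} = {k, l} \<and> (\<forall>a\<le>?n. c a > 0) \<and>
        (\<forall>a\<le>?n. \<forall>b\<le>?n. 1 - E (\<pi> a) \<bullet> E (\<pi> b) = c a * c b * (1 - E a \<bullet> E b))"
      using \<pi> by blast
  qed (use dim that in auto)
qed

section \<open>Pairs of horoballs\<close>

text \<open>
  The equality case of the Cauchy-Schwarz inequality for a unit vector.
\<close>
lemma cauchy_schwarz_unit_equality:
  fixes w e :: "'a::real_inner"
  assumes "norm e = 1" and "(norm w)\<^sup>2 = (w \<bullet> e)\<^sup>2"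
  shows "w = (w \<bullet> e) *\<^sub>R e"
proof -
  have "e \<bullet> e = 1" using assms(1) by (simp add: norm_eq_1)
  hence "(norm (w - (w \<bullet> e) *\<^sub>R e))\<^sup>2 = (norm w)\<^sup>2 - (w \<bullet> e)\<^sup>2"
    unfolding power2_norm_eq_inner
    by (simp add: inner_diff_left inner_diff_right inner_commute power2_eq_square)
  thus ?thesis using assms(2) by simp
qed

text \<open>
  Subtract from \<open>(1, x)\<close> its Lorentz-orthogonal projection to the plane of \<open>(1, e)\<close> and
  \<open>(1, f)\<close>. The remainder (scaled by \<open>1 - e \<bullet> f\<close>, this is \<open>(w0, w)\<close> in the proof) is
  orthogonal to light-like vectors, hence \<open>w \<bullet> e = w0 = w \<bullet> f\<close> and by Cauchy-Schwarz it is
  not time-like, which is the inequality. Equality forces \<open>w\<close> to be a multiple of both \<open>e\<close>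
  and \<open>f\<close>, so it vanishes and \<open>x\<close> lies on the geodesic joining \<open>e\<close> and \<open>f\<close>.
\<close>
lemma two_horoballs_inequality:
  fixes e f x :: "'a::real_inner"
  assumes e: "norm e = 1" and f: "norm f = 1" and ef: "e \<bullet> f < 1"
  shows "(1 - e \<bullet> f) * (1 - (norm x)\<^sup>2) \<le> 2 * (1 - e \<bullet> x) * (1 - f \<bullet> x)" (is ?le)
    and "(1 - e \<bullet> f) * (1 - (norm x)\<^sup>2) = 2 * (1 - e \<bullet> x) * (1 - f \<bullet> x) \<Longrightarrow>
      (1 - e \<bullet> x) + (1 - f \<bullet> x) = 1 - e \<bullet> f \<and>
      (1 - e \<bullet> f) *\<^sub>R x = (1 - f \<bullet> x) *\<^sub>R e + (1 - e \<bullet> x) *\<^sub>R f" (is "?eq \<Longrightarrow> ?concl")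
proof -
  define a b g where "a = 1 - e \<bullet> x" and "b = 1 - f \<bullet> x" and "g = 1 - e \<bullet> f"
  have g: "g > 0" using ef by (simp add: g_def)
  have ee: "e \<bullet> e = 1" "f \<bullet> f = 1" using e f by (auto simp: norm_eq_1)
  have ex: "e \<bullet> x = 1 - a" "x \<bullet> e = 1 - a" "f \<bullet> x = 1 - b" "x \<bullet> f = 1 - b"
     "e \<bullet> f = 1 - g" "f \<bullet> e = 1 - g"
    by (auto simp: a_def b_def g_def inner_commute)
  define w w0 where "w = g *\<^sub>R x - (b *\<^sub>R e + a *\<^sub>R f)" and "w0 = g - (a + b)"
  have we: "w \<bullet> e = w0" and wf: "w \<bullet> f = w0"
    by (simp_all add: w_def w0_def inner_diff_left inner_add_left ex ee algebra_simps)
  have "(norm w)\<^sup>2 = g\<^sup>2 * (norm x)\<^sup>2 - 2 * g * (b * (1 - a) + a * (1 - b)) + b\<^sup>2 + a\<^sup>2 + 2 * a * b * (1 - g)"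
    unfolding power2_norm_eq_inner
    by (simp add: w_def inner_diff_left inner_diff_right inner_add_left inner_add_right ex ee
        algebra_simps power2_eq_square)
  hence key: "(norm w)\<^sup>2 - w0\<^sup>2 = g * (2 * a * b - g * (1 - (norm x)\<^sup>2))"
    by (simp add: w0_def algebra_simps power2_eq_square)
  have "w0\<^sup>2 \<le> (norm w)\<^sup>2"
  proof -
    have "\<bar>w0\<bar> \<le> norm w" using Cauchy_Schwarz_ineq2[of w e] e we by simp
    thus ?thesis by (metis abs_ge_zero power2_abs power_mono)
  qed
  hence "0 \<le> g * (2 * a * b - g * (1 - (norm x)\<^sup>2))" using key by simp
  hence "g * (1 - (norm x)\<^sup>2) \<le> 2 * a * b" using g by (simp add: zero_le_mult_iff)
  thus ?le by (simp add: a_def b_def g_def)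
  assume ?eq
  hence "(norm w)\<^sup>2 = w0\<^sup>2" using key by (simp add: a_def b_def g_def)
  hence w: "w = w0 *\<^sub>R e" "w = w0 *\<^sub>R f"
    using cauchy_schwarz_unit_equality[OF e, of w] cauchy_schwarz_unit_equality[OF f, of w]
    unfolding we wf by blast+
  have "e \<noteq> f" using ef ee by auto
  moreover have "w0 *\<^sub>R e = w0 *\<^sub>R f" using w by (rule subst)
  ultimately have "w0 = 0" by simp
  moreover from this have "w = 0" using w(1) by simp
  ultimately show ?concl by (simp add: w_def w0_def a_def b_def g_def)
qed

text \<open>
  The scaled vectors \<open>t i * (1, E i)\<close> are light-like with pairwise Minkowski products 1, so
  their Gram matrix is \<open>J - I\<close>, which is invertible.
\<close>
locale gauged_simplex =
  fixes E :: "nat \<Rightarrow> 'a::euclidean_space" and t :: "nat \<Rightarrow> real"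
  assumes dim: "DIM('a) \<ge> 2"
    and unit: "\<And>i. i \<le> DIM('a) \<Longrightarrow> norm (E i) = 1"
    and t_pos: "\<And>i. i \<le> DIM('a) \<Longrightarrow> t i > 0"
    and gauge: "\<And>i j. i \<le> DIM('a) \<Longrightarrow> j \<le> DIM('a) \<Longrightarrow> i \<noteq> j \<Longrightarrow> t i * t j * (1 - E i \<bullet> E j) = 1"
begin

definition horoball :: "nat \<Rightarrow> real \<Rightarrow> 'a set" where
  "horoball i r = {x \<in> ball 0 1. t i * (1 - E i \<bullet> x) \<le> r * sqrt (1 - (norm x)\<^sup>2)}"

definition open_horoball :: "nat \<Rightarrow> real \<Rightarrow> 'a set" where
  "open_horoball i r = {x \<in> ball 0 1. t i * (1 - E i \<bullet> x) < r * sqrt (1 - (norm x)\<^sup>2)}"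

lemma sqrt_pos: "x \<in> ball 0 1 \<Longrightarrow> sqrt (1 - (norm x)\<^sup>2) > 0" for x :: 'a
  by (simp add: abs_square_less_1)

lemma vertex_dist_pos: "i \<le> DIM('a) \<Longrightarrow> x \<in> ball 0 1 \<Longrightarrow> 1 - E i \<bullet> x > 0"
  using norm_cauchy_schwarz[of "E i" x] unit[of i] by simp

lemma edge_pos: "i \<le> DIM('a) \<Longrightarrow> j \<le> DIM('a) \<Longrightarrow> i \<noteq> j \<Longrightarrow> E i \<bullet> E j < 1"
  using gauge[of i j] t_pos[of i] t_pos[of j]
  by (smt (verit) mult_nonneg_nonpos mult_pos_pos)

lemma inj_E: "inj_on E {..DIM('a)}"
proof (rule inj_onI, rule ccontr)
  fix i j assume "i \<in> {..DIM('a)}" "j \<in> {..DIM('a)}" and eq: "E i = E j" and "i \<noteq> j"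
  hence "E i \<bullet> E j < 1" by (intro edge_pos) auto
  moreover have "E i \<bullet> E j = 1" using eq unit[of j] \<open>j \<in> _\<close> by (simp add: norm_eq_1)
  ultimately show False by simp
qed

lemma is_horoball_iff:
  assumes i: "i \<le> DIM('a)"
  shows "is_horoball (E i) B \<longleftrightarrow> (\<exists>r>0. B = horoball i r)"
proof -
  have eq: "{x \<in> ball 0 1. busemann (E i) x \<le> c} = horoball i (t i * exp c)" for c
  proof -
    have "busemann (E i) x \<le> c \<longleftrightarrow> t i * (1 - E i \<bullet> x) \<le> t i * exp c * sqrt (1 - (norm x)\<^sup>2)"
      if x: "x \<in> ball 0 1" for x
    proof -
      have "(1 - E i \<bullet> x) / sqrt (1 - (norm x)\<^sup>2) > 0"
        using vertex_dist_pos[OF i x] sqrt_pos[OF x] by simp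
      hence "busemann (E i) x \<le> c \<longleftrightarrow> (1 - E i \<bullet> x) / sqrt (1 - (norm x)\<^sup>2) \<le> exp c"
        unfolding busemann_def by (metis exp_le_cancel_iff exp_ln)
      also have "\<dots> \<longleftrightarrow> 1 - E i \<bullet> x \<le> exp c * sqrt (1 - (norm x)\<^sup>2)"
        using sqrt_pos[OF x] by (simp only: pos_divide_le_eq)
      also have "\<dots> \<longleftrightarrow> t i * (1 - E i \<bullet> x) \<le> t i * (exp c * sqrt (1 - (norm x)\<^sup>2))"
        using t_pos[OF i] by (simp only: mult_le_cancel_left_pos)
      finally show ?thesis by (simp only: mult.assoc)
    qed
    thus ?thesis unfolding horoball_def by blast
  qed
  show ?thesis
  proof
    assume "is_horoball (E i) B"
    then obtain c where "B = horoball i (t i * exp c)" unfolding is_horoball_def eq by blast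
    thus "\<exists>r>0. B = horoball i r" using t_pos[OF i] by (intro exI[of _ "t i * exp c"]) auto
  next
    assume "\<exists>r>0. B = horoball i r"
    then obtain r where r: "r > 0" "B = horoball i r" by blast
    have "t i * exp (ln (r / t i)) = r" using t_pos[OF i] r by simp
    thus "is_horoball (E i) B" unfolding is_horoball_def eq r(2) by metis
  qed
qed

lemma open_open_horoball: "open (open_horoball i r)"
proof -
  have "open_horoball i r = ball 0 1 \<inter> {x. t i * (1 - E i \<bullet> x) < r * sqrt (1 - (norm x)\<^sup>2)}"
    by (auto simp: open_horoball_def)
  thus ?thesis by (auto intro!: open_Int open_Collect_less continuous_intros)
qed

lemma open_horoball_subset: "open_horoball i r \<subseteq> horoball i r"
  by (auto simp: open_horoball_def horoball_def)

text \<open>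
  The point of the geodesic joining \<open>E i\<close> and \<open>E j\<close> at which the products with the two
  vertex vectors are in the ratio \<open>r\<close> to \<open>s\<close>. For \<open>r * s = 1 / 2\<close> it is the point of
  tangency.
\<close>
definition contact :: "nat \<Rightarrow> nat \<Rightarrow> real \<Rightarrow> real \<Rightarrow> 'a" where
  "contact i j r s = inverse (r / t i + s / t j) *\<^sub>R ((s / t j) *\<^sub>R E i + (r / t i) *\<^sub>R E j)"

text \<open>
  The inequality \<open>two_horoballs_inequality\<close>, multiplied by \<open>t i * t j\<close>, bounds the product
  of the two (gauged) exponentials of Busemann functions below by 1/2. If \<open>r * s\<close> attains
  this bound, equality holds throughout, which pins down the common point.
\<close>
lemma horoballs_meet:
  assumes i: "i \<le> DIM('a)" and j: "j \<le> DIM('a)" and ij: "i \<noteq> j" and r: "r > 0" and s: "s > 0"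
    and x: "x \<in> horoball i r" "x \<in> horoball j s"
  shows "1 / 2 \<le> r * s" and "r * s = 1 / 2 \<Longrightarrow> x = contact i j r s"
proof -
  define a b g \<sigma> where "a = 1 - E i \<bullet> x" and "b = 1 - E j \<bullet> x" and "g = 1 - E i \<bullet> E j"
    and "\<sigma> = sqrt (1 - (norm x)\<^sup>2)"
  have x1: "x \<in> ball 0 1" using x by (simp add: horoball_def)
  have \<sigma>: "\<sigma> > 0" using sqrt_pos[OF x1] by (simp add: \<sigma>_def)
  have \<sigma>2: "\<sigma>\<^sup>2 = 1 - (norm x)\<^sup>2" using x1 by (simp add: \<sigma>_def abs_square_le_1)
  have a: "a > 0" "b > 0" using vertex_dist_pos[OF i x1] vertex_dist_pos[OF j x1] by (auto simp: a_def b_def)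
  have g: "g > 0" using edge_pos[OF i j ij] by (simp add: g_def)
  have ti: "t i > 0" "t j > 0" using t_pos i j by auto
  have tg: "t i * t j * g = 1" using gauge[OF i j ij] by (simp add: g_def)
  have le: "t i * a \<le> r * \<sigma>" "t j * b \<le> s * \<sigma>"
    using x by (auto simp: horoball_def a_def b_def \<sigma>_def)
  note ineq = two_horoballs_inequality[OF unit[OF i] unit[OF j] edge_pos[OF i j ij], of x,
    folded a_def b_def g_def \<sigma>2]
  have "t i * t j * (g * \<sigma>\<^sup>2) \<le> t i * t j * (2 * a * b)"
    using ti ineq(1) by (intro mult_left_mono) auto
  hence 1: "\<sigma>\<^sup>2 \<le> 2 * ((t i * a) * (t j * b))"
  proof -
    have "\<sigma>\<^sup>2 = (t i * t j * g) * \<sigma>\<^sup>2" unfolding tg by simp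
    also have "\<dots> = t i * t j * (g * \<sigma>\<^sup>2)" by simp
    also note \<open>t i * t j * (g * \<sigma>\<^sup>2) \<le> _\<close>
    also have "t i * t j * (2 * a * b) = 2 * ((t i * a) * (t j * b))" by simp
    finally show ?thesis .
  qed
  have 2: "(t i * a) * (t j * b) \<le> (r * \<sigma>) * (s * \<sigma>)"
    by (rule mult_mono[OF le]) (use a ti r s \<sigma> in auto)
  have 3: "(r * \<sigma>) * (s * \<sigma>) = (r * s) * \<sigma>\<^sup>2" by (simp add: power2_eq_square)
  have "1 * \<sigma>\<^sup>2 \<le> 2 * (r * s) * \<sigma>\<^sup>2" using 1 2 3 by simp
  hence "1 \<le> 2 * (r * s)" using \<sigma> by (simp only: mult_le_cancel_right_pos zero_less_power)
  thus "1 / 2 \<le> r * s" by simp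
  assume rs: "r * s = 1 / 2"
  have prod: "(t i * a) * (t j * b) = (r * \<sigma>) * (s * \<sigma>)" using 1 2 3 rs by simp
  have ra: "t i * a = r * \<sigma>"
  proof (rule ccontr)
    assume "t i * a \<noteq> r * \<sigma>"
    hence "(t i * a) * (t j * b) < (r * \<sigma>) * (s * \<sigma>)"
      by (intro mult_less_le_imp_less[of "t i * a" "r * \<sigma>"]) (use le a ti r s \<sigma> in auto)
    thus False using prod by simp
  qed
  have sb: "t j * b = s * \<sigma>" using prod ra r \<sigma> by simp
  have ab: "a = (r / t i) * \<sigma>" "b = (s / t j) * \<sigma>"
    using ra sb ti by (auto simp: field_simps)
  have "g * \<sigma>\<^sup>2 = 2 * a * b"
  proof -
    have "2 * ((t i * a) * (t j * b)) = \<sigma>\<^sup>2" using prod 3 rs by simp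
    hence "(t i * t j) * (2 * a * b) = \<sigma>\<^sup>2" by (simp only: mult_ac)
    also have "\<dots> = (t i * t j * g) * \<sigma>\<^sup>2" unfolding tg by simp
    also have "\<dots> = (t i * t j) * (g * \<sigma>\<^sup>2)" by simp
    finally have "(t i * t j) * (2 * a * b) = (t i * t j) * (g * \<sigma>\<^sup>2)" .
    thus ?thesis using ti by simp
  qed
  from ineq(2)[OF this] have abg: "a + b = g" and gx: "g *\<^sub>R x = b *\<^sub>R E i + a *\<^sub>R E j" by auto
  define d where "d = r / t i + s / t j"
  have d: "d > 0" using r s ti by (simp add: d_def add_pos_pos)
  have "g = d * \<sigma>" using abg ab by (simp add: d_def algebra_simps)
  hence "\<sigma> *\<^sub>R (d *\<^sub>R x) = \<sigma> *\<^sub>R ((s / t j) *\<^sub>R E i + (r / t i) *\<^sub>R E j)"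
    using gx ab by (simp add: scaleR_add_right mult.commute)
  hence "d *\<^sub>R x = (s / t j) *\<^sub>R E i + (r / t i) *\<^sub>R E j"
    using \<sigma> scaleR_left_imp_eq[of \<sigma>] by blast
  hence "inverse d *\<^sub>R (d *\<^sub>R x) = contact i j r s" by (simp add: contact_def d_def)
  thus "x = contact i j r s" using d by simp
qed

text \<open>
  The square root is at least 1 iff the point lies in the horoball of radius \<open>r\<close>, and by
  symmetry iff it lies in the other one.
\<close>
lemma contact_mem:
  assumes i: "i \<le> DIM('a)" and j: "j \<le> DIM('a)" and ij: "i \<noteq> j" and r: "r > 0" and s: "s > 0"
  shows "contact i j r s \<in> ball 0 1" (is ?ball)
    and "t i * (1 - E i \<bullet> contact i j r s) * sqrt (2 * (r * s)) = r * sqrt (1 - (norm (contact i j r s))\<^sup>2)" (is ?eq)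
proof -
  define p \<alpha> \<beta> g d where "p = contact i j r s" and "\<alpha> = r / t i" and "\<beta> = s / t j"
     and "g = 1 - E i \<bullet> E j" and "d = \<alpha> + \<beta>"
  have ti: "t i > 0" "t j > 0" using t_pos i j by auto
  have ab: "\<alpha> > 0" "\<beta> > 0" using r s ti by (auto simp: \<alpha>_def \<beta>_def)
  hence d: "d > 0" by (simp add: d_def)
  have g: "g > 0" using edge_pos[OF i j ij] by (simp add: g_def)
  have tg: "t i * t j * g = 1" using gauge[OF i j ij] by (simp add: g_def)
  have p: "d *\<^sub>R p = \<beta> *\<^sub>R E i + \<alpha> *\<^sub>R E j"
    using d by (simp add: p_def contact_def \<alpha>_def \<beta>_def d_def)
  have ee: "E i \<bullet> E i = 1" "E j \<bullet> E j = 1" "E i \<bullet> E j = 1 - g" "E j \<bullet> E i = 1 - g"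
    using unit i j by (auto simp: norm_eq_1 g_def inner_commute)
  have "d * (E i \<bullet> p) = E i \<bullet> (d *\<^sub>R p)" by simp
  also have "\<dots> = d - \<alpha> * g" unfolding p inner_add_right by (simp add: ee d_def algebra_simps)
  finally have ei: "d * (1 - E i \<bullet> p) = \<alpha> * g" by (simp add: algebra_simps)
  have "d\<^sup>2 * (norm p)\<^sup>2 = (d *\<^sub>R p) \<bullet> (d *\<^sub>R p)"
    by (simp add: power2_norm_eq_inner[symmetric] power2_eq_square) 
  also have "\<dots> = d\<^sup>2 - 2 * (\<alpha> * \<beta>) * g"
    unfolding p inner_add_right inner_add_left
    by (simp add: ee d_def algebra_simps power2_eq_square)
  finally have np: "d\<^sup>2 * (1 - (norm p)\<^sup>2) = 2 * (\<alpha> * \<beta>) * g" by (simp add: algebra_simps)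
  have "\<alpha> * \<beta> = r * s * g" using tg ti
    by (simp add: \<alpha>_def \<beta>_def field_simps)
  hence np2: "d\<^sup>2 * (1 - (norm p)\<^sup>2) = 2 * (r * s) * g\<^sup>2" using np by (simp add: power2_eq_square)
  have "0 < d\<^sup>2 * (1 - (norm p)\<^sup>2)" unfolding np using ab g by simp
  hence "0 < 1 - (norm p)\<^sup>2" using d by (simp add: zero_less_mult_iff)
  hence "norm p < 1" by (simp add: abs_square_less_1)
  thus ?ball by (simp add: p_def)
  have "d * sqrt (1 - (norm p)\<^sup>2) = sqrt (2 * (r * s)) * g"
  proof -
    have "sqrt (d\<^sup>2 * (1 - (norm p)\<^sup>2)) = sqrt (2 * (r * s) * g\<^sup>2)" by (simp only: np2)
    thus ?thesis using d g by (simp only: real_sqrt_mult real_sqrt_abs abs_of_pos)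
  qed
  hence "d * (r * sqrt (1 - (norm p)\<^sup>2)) = r * (sqrt (2 * (r * s)) * g)" by simp
  moreover have "d * (t i * (1 - E i \<bullet> p) * sqrt (2 * (r * s))) = r * (sqrt (2 * (r * s)) * g)"
  proof -
    have "d * (t i * (1 - E i \<bullet> p) * sqrt (2 * (r * s))) = t i * (d * (1 - E i \<bullet> p)) * sqrt (2 * (r * s))"
      by simp
    also have "\<dots> = r * (sqrt (2 * (r * s)) * g)" unfolding ei using ti by (simp add: \<alpha>_def)
    finally show ?thesis .
  qed
  ultimately have "d * (t i * (1 - E i \<bullet> p) * sqrt (2 * (r * s))) = d * (r * sqrt (1 - (norm p)\<^sup>2))" by (simp only:)
  moreover have "d \<noteq> 0" using d by simp
  ultimately show ?eq by (simp only: mult_cancel_left p_def simp_thms)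
qed

lemma contact_in_horoball:
  assumes i: "i \<le> DIM('a)" and j: "j \<le> DIM('a)" and ij: "i \<noteq> j" and r: "r > 0" and s: "s > 0"
  shows "r * s \<ge> 1 / 2 \<Longrightarrow> contact i j r s \<in> horoball i r"
    and "r * s > 1 / 2 \<Longrightarrow> contact i j r s \<in> open_horoball i r"
proof -
  let ?p = "contact i j r s"
  note c = contact_mem[OF i j ij r s]
  have pos: "t i * (1 - E i \<bullet> ?p) > 0" using t_pos[OF i] vertex_dist_pos[OF i c(1)] by simp
  { assume "r * s \<ge> 1 / 2"
    hence "t i * (1 - E i \<bullet> ?p) * 1 \<le> t i * (1 - E i \<bullet> ?p) * sqrt (2 * (r * s))"
      using pos by (intro mult_left_mono) auto
    thus "?p \<in> horoball i r" using c by (simp add: horoball_def) }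
  { assume "r * s > 1 / 2"
    hence "t i * (1 - E i \<bullet> ?p) * 1 < t i * (1 - E i \<bullet> ?p) * sqrt (2 * (r * s))"
      using pos by (intro mult_strict_left_mono) auto
    thus "?p \<in> open_horoball i r" using c by (simp add: open_horoball_def) }
qed

lemma contact_commute: "contact i j r s = contact j i s r"
  by (simp add: contact_def add.commute)

lemma open_horoballs_meet:
  assumes "i \<le> DIM('a)" "j \<le> DIM('a)" "i \<noteq> j" "r > 0" "s > 0" "r * s > 1 / 2"
  shows "contact i j r s \<in> open_horoball i r \<inter> open_horoball j s"
  using contact_in_horoball(2)[of i j r s] contact_in_horoball(2)[of j i s r] assms
  by (auto simp: contact_commute[of j i s r] mult.commute)

text \<open>
  In the borderline case \<open>r * s = 1 / 2\<close> the horoballs share a single point, and a single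
  point contains no nonempty open set.
\<close>
lemma horoballs_not_overlapping_iff:
  assumes i: "i \<le> DIM('a)" and j: "j \<le> DIM('a)" and ij: "i \<noteq> j" and r: "r > 0" and s: "s > 0"
  shows "interior (horoball i r) \<inter> interior (horoball j s) = {} \<longleftrightarrow> r * s \<le> 1 / 2"
proof
  assume *: "interior (horoball i r) \<inter> interior (horoball j s) = {}"
  have "open_horoball i r \<inter> open_horoball j s \<subseteq> interior (horoball i r) \<inter> interior (horoball j s)"
    by (intro Int_mono interior_maximal open_horoball_subset open_open_horoball)
  thus "r * s \<le> 1 / 2" using open_horoballs_meet[OF i j ij r s] * by force
next
  assume rs: "r * s \<le> 1 / 2"
  show "interior (horoball i r) \<inter> interior (horoball j s) = {}"
  proof (rule ccontr)
    assume "\<not> ?thesis"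
    then obtain x where x: "x \<in> interior (horoball i r) \<inter> interior (horoball j s)" by blast
    have sub: "interior (horoball i r) \<inter> interior (horoball j s) \<subseteq> horoball i r \<inter> horoball j s"
      using interior_subset by blast
    have "r * s = 1 / 2" using horoballs_meet(1)[OF i j ij r s, of x] x sub rs by force
    hence "interior (horoball i r) \<inter> interior (horoball j s) \<subseteq> {contact i j r s}"
      using horoballs_meet(2)[OF i j ij r s] sub by blast
    hence "interior (horoball i r) \<inter> interior (horoball j s) = {contact i j r s}"
      using x by blast
    thus False by (metis not_open_singleton open_Int open_interior)
  qed
qed

lemma horoballs_tangent_iff:
  assumes i: "i \<le> DIM('a)" and j: "j \<le> DIM('a)" and ij: "i \<noteq> j" and r: "r > 0" and s: "s > 0"
  shows "horoballs_tangent (horoball i r) (horoball j s) \<longleftrightarrow> r * s = 1 / 2"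
proof
  assume "horoballs_tangent (horoball i r) (horoball j s)"
  then obtain p where p: "horoball i r \<inter> horoball j s = {p}" by (auto simp: horoballs_tangent_def)
  have "1 / 2 \<le> r * s" using horoballs_meet(1)[OF i j ij r s, of p] p by blast
  moreover have "\<not> r * s > 1 / 2"
  proof
    assume "r * s > 1 / 2"
    hence "contact i j r s \<in> open_horoball i r \<inter> open_horoball j s"
      using open_horoballs_meet i j ij r s by blast
    moreover have "open_horoball i r \<inter> open_horoball j s \<subseteq> {p}"
      using p open_horoball_subset by blast
    ultimately have "open_horoball i r \<inter> open_horoball j s = {p}" by blast
    thus False by (metis not_open_singleton open_Int open_open_horoball)
  qed
  ultimately show "r * s = 1 / 2" by simp
next
  assume rs: "r * s = 1 / 2"
  have "contact i j r s \<in> horoball i r" using contact_in_horoball(1)[OF i j ij r s] rs by simp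
  moreover have "contact i j r s \<in> horoball j s"
    using contact_in_horoball(1)[OF j i ij[symmetric] s r] rs by (simp add: contact_commute[of i j] mult.commute)
  moreover have "horoball i r \<inter> horoball j s \<subseteq> {contact i j r s}"
    using horoballs_meet(2)[OF i j ij r s] rs by blast
  ultimately have "horoball i r \<inter> horoball j s = {contact i j r s}" by blast
  thus "horoballs_tangent (horoball i r) (horoball j s)" by (auto simp: horoballs_tangent_def)
qed

section \<open>Horoballs and opposite faces\<close>

text \<open>
  \<open>mass z\<close> and \<open>bary z\<close> are the time and space components of the Minkowski vector with
  coordinates \<open>z\<close> with respect to the vectors \<open>t j * (1, E j)\<close>.
\<close>
definition mass :: "(nat \<Rightarrow> real) \<Rightarrow> real" where
  "mass z = (\<Sum>j\<le>DIM('a). z j * t j)"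

definition bary :: "(nat \<Rightarrow> real) \<Rightarrow> 'a" where
  "bary z = (\<Sum>j\<le>DIM('a). (z j * t j) *\<^sub>R E j)"

text \<open>
  The product of a vertex vector with a combination of vertex vectors, read off the Gram
  matrix \<open>J - I\<close>.
\<close>
lemma pairing_vertex:
  assumes i: "i \<le> DIM('a)"
  shows "t i * (mass z - E i \<bullet> bary z) = (\<Sum>j\<le>DIM('a). z j) - z i"
proof -
  have ee: "E i \<bullet> E i = 1" using unit[OF i] by (simp add: norm_eq_1)
  have "t i * (mass z - E i \<bullet> bary z) = (\<Sum>j\<le>DIM('a). z j * (t i * t j * (1 - E i \<bullet> E j)))"
    unfolding mass_def bary_def inner_sum_right
    by (simp add: sum_subtractf[symmetric] sum_distrib_left algebra_simps)
  also have "\<dots> = (\<Sum>j\<le>DIM('a). if j = i then 0 else z j)"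
    using i ee by (intro sum.cong) (auto simp: gauge)
  also have "\<dots> = (\<Sum>j\<in>{..DIM('a)} - {i}. z j)"
    by (intro sum.mono_neutral_cong_right) auto
  also have "\<dots> = (\<Sum>j\<le>DIM('a). z j) - z i"
    using i by (simp add: sum_diff1)
  finally show ?thesis .
qed

lemma pairing_self:
  "(mass z)\<^sup>2 - (norm (bary z))\<^sup>2 = (\<Sum>j\<le>DIM('a). z j)\<^sup>2 - (\<Sum>j\<le>DIM('a). (z j)\<^sup>2)"
proof -
  have "(norm (bary z))\<^sup>2 = (\<Sum>i\<le>DIM('a). z i * t i * (E i \<bullet> bary z))"
    unfolding power2_norm_eq_inner
    by (subst (1) bary_def) (simp add: inner_sum_left)
  moreover have "(mass z)\<^sup>2 = (\<Sum>i\<le>DIM('a). z i * t i * mass z)"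
    unfolding power2_eq_square by (subst (1) mass_def) (simp only: sum_distrib_right)
  ultimately have "(mass z)\<^sup>2 - (norm (bary z))\<^sup>2 = (\<Sum>i\<le>DIM('a). z i * (t i * (mass z - E i \<bullet> bary z)))"
    by (simp add: sum_subtractf[symmetric] right_diff_distrib mult.assoc)
  also have "\<dots> = (\<Sum>i\<le>DIM('a). z i * ((\<Sum>j\<le>DIM('a). z j) - z i))"
    by (intro sum.cong refl) (simp add: pairing_vertex)
  also have "\<dots> = (\<Sum>j\<le>DIM('a). z j)\<^sup>2 - (\<Sum>j\<le>DIM('a). (z j)\<^sup>2)"
    by (simp add: right_diff_distrib sum_subtractf sum_distrib_right[symmetric] power2_eq_square)
  finally show ?thesis .
qed

lemma affine_hull_coords:
  assumes "J \<subseteq> {..DIM('a)}"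
  shows "affine hull (E ` J) = {bary z | z. (\<forall>j\<le>DIM('a). j \<notin> J \<longrightarrow> z j = 0) \<and> mass z = 1}"
proof -
  have inj: "inj_on E J" using inj_E assms by (rule inj_on_subset)
  have fin: "finite J" using assms by (rule finite_subset) simp
  have "x \<in> affine hull (E ` J) \<longleftrightarrow> (\<exists>u. sum u J = 1 \<and> (\<Sum>j\<in>J. u j *\<^sub>R E j) = x)" for x
  proof
    assume "x \<in> affine hull (E ` J)"
    then obtain u where "sum u (E ` J) = 1" "(\<Sum>v\<in>E ` J. u v *\<^sub>R v) = x"
      using fin by (auto simp: affine_hull_finite)
    thus "\<exists>u. sum u J = 1 \<and> (\<Sum>j\<in>J. u j *\<^sub>R E j) = x"
      by (intro exI[of _ "u \<circ> E"]) (simp add: sum.reindex[OF inj])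
  next
    assume "\<exists>u. sum u J = 1 \<and> (\<Sum>j\<in>J. u j *\<^sub>R E j) = x"
    then obtain u where u: "sum u J = 1" "(\<Sum>j\<in>J. u j *\<^sub>R E j) = x" by blast
    define v where "v = u \<circ> the_inv_into J E"
    have "v (E j) = u j" if "j \<in> J" for j using that inj by (simp add: v_def the_inv_into_f_f)
    hence "sum v (E ` J) = 1" "(\<Sum>y\<in>E ` J. v y *\<^sub>R y) = x"
      using u by (simp_all add: sum.reindex[OF inj])
    thus "x \<in> affine hull (E ` J)" using fin by (auto simp: affine_hull_finite)
  qed
  also have "(\<exists>u. sum u J = 1 \<and> (\<Sum>j\<in>J. u j *\<^sub>R E j) = x) \<longleftrightarrow>
    (\<exists>z. (\<forall>j\<le>DIM('a). j \<notin> J \<longrightarrow> z j = 0) \<and> mass z = 1 \<and> bary z = x)" for x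
  proof
    assume "\<exists>u. sum u J = 1 \<and> (\<Sum>j\<in>J. u j *\<^sub>R E j) = x"
    then obtain u where u: "sum u J = 1" "(\<Sum>j\<in>J. u j *\<^sub>R E j) = x" by blast
    define z where "z = (\<lambda>j. if j \<in> J then u j / t j else 0)"
    have zt: "z j * t j = u j" if "j \<in> J" for j
    proof -
      have "t j > 0" using that t_pos assms by auto
      thus ?thesis using that by (simp add: z_def)
    qed
    have z0: "z j = 0" if "j \<notin> J" for j using that by (simp add: z_def)
    have "mass z = sum u J" unfolding mass_def
      using assms by (intro sum.mono_neutral_cong_right) (auto simp: z0 zt)
    moreover have "bary z = (\<Sum>j\<in>J. u j *\<^sub>R E j)" unfolding bary_def
      using assms by (intro sum.mono_neutral_cong_right) (auto simp: z0 zt)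
    ultimately show "\<exists>z. (\<forall>j\<le>DIM('a). j \<notin> J \<longrightarrow> z j = 0) \<and> mass z = 1 \<and> bary z = x"
      using u by (intro exI[of _ z]) (auto simp: z_def)
  next
    assume "\<exists>z. (\<forall>j\<le>DIM('a). j \<notin> J \<longrightarrow> z j = 0) \<and> mass z = 1 \<and> bary z = x"
    then obtain z where z: "\<And>j. j \<le> DIM('a) \<Longrightarrow> j \<notin> J \<Longrightarrow> z j = 0" "mass z = 1" "bary z = x" by blast
    have "mass z = (\<Sum>j\<in>J. z j * t j)" unfolding mass_def
      using assms z(1) by (intro sum.mono_neutral_cong_right) auto
    moreover have "bary z = (\<Sum>j\<in>J. (z j * t j) *\<^sub>R E j)" unfolding bary_def
      using assms z(1) by (intro sum.mono_neutral_cong_right) auto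
    ultimately show "\<exists>u. sum u J = 1 \<and> (\<Sum>j\<in>J. u j *\<^sub>R E j) = x"
      using z by (intro exI[of _ "\<lambda>j. z j * t j"]) auto
  qed
  finally have *: "x \<in> affine hull (E ` J) \<longleftrightarrow>
    (\<exists>z. (\<forall>j\<le>DIM('a). j \<notin> J \<longrightarrow> z j = 0) \<and> mass z = 1 \<and> bary z = x)" for x .
  show ?thesis unfolding set_eq_iff mem_Collect_eq * by (auto simp only:)
qed

text \<open>
  The largest radius of a horoball that does not cross the hyperplane opposite to its
  centre.
\<close>
definition face_radius :: real where
  "face_radius = sqrt (real DIM('a) / (real DIM('a) - 1))"

lemma face_radius_pos: "face_radius > 0"
  using dim by (simp add: face_radius_def)

lemma face_radius_sq: "face_radius\<^sup>2 = real DIM('a) / (real DIM('a) - 1)"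
  using dim by (simp add: face_radius_def)

lemma face_radius_le_iff:
  assumes "r > 0"
  shows "face_radius \<le> r \<longleftrightarrow> real DIM('a) \<le> r\<^sup>2 * (real DIM('a) - 1)"
proof -
  have "face_radius \<le> r \<longleftrightarrow> face_radius\<^sup>2 \<le> r\<^sup>2"
    using assms face_radius_pos by (simp add: abs_le_square_iff[symmetric])
  thus ?thesis using dim by (simp add: face_radius_sq pos_divide_le_eq)
qed

lemma le_face_radius_iff:
  assumes "r > 0"
  shows "r \<le> face_radius \<longleftrightarrow> r\<^sup>2 * (real DIM('a) - 1) \<le> real DIM('a)"
proof -
  have "r \<le> face_radius \<longleftrightarrow> r\<^sup>2 \<le> face_radius\<^sup>2"
    using assms face_radius_pos by (simp add: abs_le_square_iff[symmetric])
  thus ?thesis using dim by (simp add: face_radius_sq pos_le_divide_eq)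
qed

text \<open>
  Equal coordinates on the face opposite to \<open>E i\<close>, normalized to total mass 1: its
  hyperbolic centre.
\<close>
definition foot_coords :: "nat \<Rightarrow> nat \<Rightarrow> real" where
  "foot_coords i j = (if j = i then 0 else 1 / (\<Sum>k\<in>{..DIM('a)} - {i}. t k))"

abbreviation foot :: "nat \<Rightarrow> 'a" where
  "foot i \<equiv> bary (foot_coords i)"

lemma sum_without:
  assumes "i \<le> DIM('a)" "z i = (0::real)"
  shows "(\<Sum>j\<le>DIM('a). z j) = (\<Sum>j\<in>{..DIM('a)} - {i}. z j)"
  using assms by (intro sum.mono_neutral_right) auto

text \<open>
  On the opposite face the coordinates \<open>z j\<close> satisfy \<open>S\<^sup>2 \<le> n * Q\<close>, where \<open>S\<close> is their sum
  and \<open>Q\<close> the sum of their squares, while membership in the horoball means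
  \<open>S\<^sup>2 \<le> r\<^sup>2 * (S\<^sup>2 - Q)\<close>. Equality makes the coordinates equal.
\<close>
lemma horoball_face_bound:
  assumes i: "i \<le> DIM('a)" and r: "r > 0" and x: "x \<in> horoball i r" "x \<in> face_hyperplane E i"
  shows "face_radius \<le> r" and "r = face_radius \<Longrightarrow> x = foot i"
proof -
  let ?J = "{..DIM('a)} - {i}"
  define n where "n = real DIM('a)"
  have n: "n \<ge> 2" using dim by (simp add: n_def)
  have cardJ: "real (card ?J) = n" using i by (simp add: n_def)
  have x1: "x \<in> ball 0 1" using x by (simp add: horoball_def)
  from x(2) obtain z where z: "z i = 0" "mass z = 1" "x = bary z"
    unfolding face_hyperplane_def affine_hull_coords[OF Diff_subset] using i by blast
  define S where "S = (\<Sum>j\<in>?J. z j)"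
  define Q where "Q = (\<Sum>j\<in>?J. (z j)\<^sup>2)"
  have S: "t i * (1 - E i \<bullet> x) = S"
    using pairing_vertex[OF i, of z] z sum_without[of i z] i by (simp add: S_def)
  have Q: "1 - (norm x)\<^sup>2 = S\<^sup>2 - Q"
    using pairing_self[of z] z sum_without[of i z] sum_without[of i "\<lambda>j. (z j)\<^sup>2"] i
    by (simp add: S_def Q_def)
  have S0: "S > 0" using S t_pos[OF i] vertex_dist_pos[OF i x1] by (metis mult_pos_pos)
  have CS: "S\<^sup>2 \<le> Q * n"
    using sum_squared_le_sum_of_squares[of z ?J] by (simp add: S_def Q_def cardJ[simplified])
  have "S \<le> r * sqrt (S\<^sup>2 - Q)" using x(1) by (simp add: horoball_def S Q)
  hence "S\<^sup>2 \<le> (r * sqrt (S\<^sup>2 - Q))\<^sup>2" using S0 by (intro power_mono) auto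
  moreover have "0 \<le> S\<^sup>2 - Q" using x1 by (simp add: Q[symmetric] abs_square_le_1)
  ultimately have le: "S\<^sup>2 \<le> r\<^sup>2 * (S\<^sup>2 - Q)" by (simp add: power_mult_distrib)
  have "n * S\<^sup>2 \<le> r\<^sup>2 * (n * S\<^sup>2 - Q * n)"
    using mult_left_mono[OF le, of n] n by (simp add: algebra_simps)
  also have "\<dots> \<le> r\<^sup>2 * (n * S\<^sup>2 - S\<^sup>2)" using CS by (intro mult_left_mono) auto
  finally have "n * S\<^sup>2 \<le> (r\<^sup>2 * (n - 1)) * S\<^sup>2" by (simp add: algebra_simps)
  hence "n \<le> r\<^sup>2 * (n - 1)" using S0 by simp
  thus "face_radius \<le> r" using face_radius_le_iff[OF r] by (simp add: n_def)
  assume "r = face_radius"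
  hence r2: "r\<^sup>2 = n / (n - 1)" by (simp add: face_radius_sq n_def)
  have "(n - 1) * S\<^sup>2 \<le> n * (S\<^sup>2 - Q)"
    using le n unfolding r2 by (simp add: field_simps)
  hence Qn: "Q * n = S\<^sup>2" using CS by (simp add: algebra_simps)
  have "(\<Sum>j\<in>?J. (z j - c)\<^sup>2) = Q - 2 * c * S + n * c\<^sup>2" for c
  proof -
    have "(\<Sum>j\<in>?J. (z j - c)\<^sup>2) = (\<Sum>j\<in>?J. (z j)\<^sup>2 - 2 * c * z j + c\<^sup>2)"
      by (simp add: power2_diff algebra_simps)
    also have "\<dots> = Q - 2 * c * S + real (card ?J) * c\<^sup>2"
      unfolding Q_def S_def by (simp only: sum.distrib sum_subtractf sum_distrib_left sum_constant)
    finally show ?thesis unfolding cardJ .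
  qed
  hence "(\<Sum>j\<in>?J. (z j - S / n)\<^sup>2) = Q - 2 * (S / n) * S + n * (S / n)\<^sup>2" .
  also have "\<dots> = 0" using Qn n by (simp add: field_simps power2_eq_square)
  finally have "\<forall>j\<in>?J. (z j - S / n)\<^sup>2 = 0"
    by (subst (asm) sum_nonneg_eq_0_iff) auto
  hence zj: "z j = S / n" if "j \<in> ?J" for j using that by auto
  have "1 = (\<Sum>j\<in>?J. z j * t j)"
    using z sum_without[of i "\<lambda>j. z j * t j"] i by (simp add: mass_def)
  also have "\<dots> = S / n * (\<Sum>j\<in>?J. t j)" using zj by (simp add: sum_distrib_left)
  finally have "S / n = 1 / (\<Sum>j\<in>?J. t j)" by (metis div_by_1 mult_zero_right nonzero_eq_divide_eq zero_neq_one)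
  hence "\<forall>j\<le>DIM('a). z j = foot_coords i j" using zj z by (auto simp: foot_coords_def)
  thus "x = foot i" unfolding z bary_def by (intro sum.cong) auto
qed

lemma sum_t_pos:
  assumes "i \<le> DIM('a)"
  shows "(\<Sum>j\<in>{..DIM('a)} - {i}. t j) > 0"
proof (rule sum_pos)
  have "card ({..DIM('a)} - {i}) = DIM('a)" using assms by simp
  thus "{..DIM('a)} - {i} \<noteq> {}" using dim by (metis card.empty not_numeral_le_zero)
qed (auto intro: t_pos)

lemma foot_in_face:
  assumes i: "i \<le> DIM('a)"
  shows "foot i \<in> face E ({..DIM('a)} - {i})"
proof -
  let ?J = "{..DIM('a)} - {i}"
  define \<tau> where "\<tau> = 1 / (\<Sum>k\<in>?J. t k)"
  have \<tau>: "\<tau> > 0" using sum_t_pos[OF i] by (simp add: \<tau>_def)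
  have "foot i = (\<Sum>j\<in>?J. (\<tau> * t j) *\<^sub>R E j)"
    unfolding bary_def using i
    by (intro sum.mono_neutral_cong_right) (auto simp: foot_coords_def \<tau>_def)
  also have "\<dots> \<in> convex hull (E ` ?J)"
  proof (rule convex_sum)
    show "(\<Sum>j\<in>?J. \<tau> * t j) = 1"
      using sum_t_pos[OF i] by (simp add: \<tau>_def sum_divide_distrib[symmetric])
    show "\<And>j. j \<in> ?J \<Longrightarrow> E j \<in> convex hull E ` ?J" by (simp add: hull_inc)
    show "\<And>j. j \<in> ?J \<Longrightarrow> 0 \<le> \<tau> * t j"
      using \<tau> t_pos by (simp add: order_less_imp_le)
  qed auto
  finally show ?thesis by (simp add: face_def)
qed

lemma foot_mem:
  assumes i: "i \<le> DIM('a)"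
  shows "foot i \<in> ball 0 1"
    and "t i * (1 - E i \<bullet> foot i) = face_radius * sqrt (1 - (norm (foot i))\<^sup>2)"
proof -
  let ?J = "{..DIM('a)} - {i}"
  define \<tau> n where "\<tau> = 1 / (\<Sum>k\<in>?J. t k)" and "n = real DIM('a)"
  have \<tau>: "\<tau> > 0" using sum_t_pos[OF i] by (simp add: \<tau>_def)
  have n: "n \<ge> 2" using dim by (simp add: n_def)
  have cardJ: "real (card ?J) = n" using i by (simp add: n_def)
  have z0: "foot_coords i i = 0" by (simp add: foot_coords_def)
  have m: "mass (foot_coords i) = 1"
  proof -
    have "mass (foot_coords i) = (\<Sum>j\<in>?J. \<tau> * t j)"
      unfolding mass_def using i
      by (intro sum.mono_neutral_cong_right) (auto simp: foot_coords_def \<tau>_def)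
    also have "\<dots> = 1" using sum_t_pos[OF i] by (simp add: \<tau>_def sum_divide_distrib[symmetric])
    finally show ?thesis .
  qed
  have s1: "(\<Sum>j\<le>DIM('a). foot_coords i j) = n * \<tau>"
  proof -
    have "(\<Sum>j\<le>DIM('a). foot_coords i j) = (\<Sum>j\<in>?J. \<tau>)"
      using i by (intro sum.mono_neutral_cong_right) (auto simp: foot_coords_def \<tau>_def)
    thus ?thesis using cardJ by simp
  qed
  have s2: "(\<Sum>j\<le>DIM('a). (foot_coords i j)\<^sup>2) = n * \<tau>\<^sup>2"
  proof -
    have "(\<Sum>j\<le>DIM('a). (foot_coords i j)\<^sup>2) = (\<Sum>j\<in>?J. \<tau>\<^sup>2)"
      using i by (intro sum.mono_neutral_cong_right) (auto simp: foot_coords_def \<tau>_def)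
    thus ?thesis using cardJ by simp
  qed
  have A: "t i * (1 - E i \<bullet> foot i) = n * \<tau>"
    using pairing_vertex[OF i, of "foot_coords i"] by (simp add: m s1 z0)
  have B: "1 - (norm (foot i))\<^sup>2 = n * (n - 1) * \<tau>\<^sup>2"
    using pairing_self[of "foot_coords i"] unfolding m s1 s2
    by (simp add: power2_eq_square algebra_simps)
  have "0 < n * (n - 1) * \<tau>\<^sup>2" using n \<tau> by simp
  hence "0 < 1 - (norm (foot i))\<^sup>2" by (simp only: B)
  thus "foot i \<in> ball 0 1" by (simp add: abs_square_less_1)
  have "face_radius * sqrt (1 - (norm (foot i))\<^sup>2) = sqrt (n / (n - 1) * (n * (n - 1) * \<tau>\<^sup>2))"
    unfolding B face_radius_def n_def[symmetric] by (simp only: real_sqrt_mult)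
  also have "n / (n - 1) * (n * (n - 1) * \<tau>\<^sup>2) = (n * \<tau>)\<^sup>2"
    using n by (simp add: power2_eq_square field_simps)
  also have "sqrt \<dots> = n * \<tau>" using n \<tau> by simp
  finally show "t i * (1 - E i \<bullet> foot i) = face_radius * sqrt (1 - (norm (foot i))\<^sup>2)"
    using A by simp
qed

lemma foot_in_hyperplane:
  assumes i: "i \<le> DIM('a)"
  shows "foot i \<in> affine hull (E ` ({..DIM('a)} - {i}))" "foot i \<in> face_hyperplane E i"
  using foot_in_face[OF i] foot_mem(1)[OF i] convex_hull_subset_affine_hull
  by (auto simp: face_def face_hyperplane_def)

text \<open>
  The centre of the face is then interior to the horoball, and moving it a little along an
  edge of the face gives a second common point. This needs two vertices besides \<open>E i\<close>.
\<close>
lemma horoball_crosses_face: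
  assumes i: "i \<le> DIM('a)" and r: "r > face_radius"
  shows "\<not> (\<exists>p. horoball i r \<inter> face_hyperplane E i \<subseteq> {p})"
proof -
  let ?J = "{..DIM('a)} - {i}" and ?A = "affine hull (E ` ({..DIM('a)} - {i}))"
  have "t i * (1 - E i \<bullet> foot i) < r * sqrt (1 - (norm (foot i))\<^sup>2)"
    unfolding foot_mem(2)[OF i] using r sqrt_pos[OF foot_mem(1)[OF i]]
    by (intro mult_strict_right_mono) auto
  hence f: "foot i \<in> open_horoball i r" using foot_mem(1)[OF i] by (simp add: open_horoball_def)
  then obtain e where e: "e > 0" "ball (foot i) e \<subseteq> open_horoball i r"
    using open_open_horoball open_contains_ball by blast
  have "2 \<le> card ?J" using i dim by simp
  then obtain j k where jk: "j \<in> ?J" "k \<in> ?J" "j \<noteq> k"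
    by (metis card_le_Suc0_iff_eq finite_Diff finite_atMost not_less_eq_eq numeral_2_eq_2)
  have ne: "E j \<noteq> E k" using jk inj_E by (auto simp: inj_on_def)
  define \<epsilon> where "\<epsilon> = e / 2 / norm (E j - E k)"
  have \<epsilon>: "\<epsilon> > 0" using e ne by (simp add: \<epsilon>_def)
  define q where "q = foot i + \<epsilon> *\<^sub>R (E j - E k)"
  have "q \<in> ?A" unfolding q_def using jk foot_in_hyperplane(1)[OF i]
    by (intro mem_affine_3_minus) (auto simp: hull_inc)
  have "dist (foot i) q = e / 2" using ne e by (simp add: q_def dist_norm \<epsilon>_def)
  hence "q \<in> ball (foot i) e" using e by simp
  hence "q \<in> open_horoball i r" using e by blast
  hence q: "q \<in> horoball i r \<inter> face_hyperplane E i"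
    using \<open>q \<in> ?A\<close> by (auto simp: face_hyperplane_def horoball_def open_horoball_def)
  have fq: "foot i \<in> horoball i r \<inter> face_hyperplane E i"
    using f open_horoball_subset foot_in_hyperplane(2)[OF i] by blast
  have "q \<noteq> foot i" using \<epsilon> ne by (simp add: q_def)
  thus ?thesis using q fq by blast
qed

lemma horoball_within_face_iff:
  assumes i: "i \<le> DIM('a)" and r: "r > 0"
  shows "(\<exists>p. horoball i r \<inter> face_hyperplane E i \<subseteq> {p}) \<longleftrightarrow> r \<le> face_radius"
proof
  assume "\<exists>p. horoball i r \<inter> face_hyperplane E i \<subseteq> {p}"
  thus "r \<le> face_radius" using horoball_crosses_face[OF i, of r] by force
next
  assume "r \<le> face_radius"
  hence "horoball i r \<inter> face_hyperplane E i \<subseteq> {foot i}"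
    using horoball_face_bound[OF i r] by force
  thus "\<exists>p. horoball i r \<inter> face_hyperplane E i \<subseteq> {p}" by blast
qed

lemma tangent_to_face_iff:
  assumes i: "i \<le> DIM('a)" and r: "r > 0"
  shows "tangent_to_face E i (horoball i r) \<longleftrightarrow> r = face_radius"
proof
  assume "tangent_to_face E i (horoball i r)"
  then obtain p where p: "horoball i r \<inter> face_hyperplane E i = {p}"
    by (auto simp: tangent_to_face_def)
  hence "r \<le> face_radius" using horoball_within_face_iff[OF i r] by blast
  moreover have "face_radius \<le> r" using horoball_face_bound(1)[OF i r, of p] p by blast
  ultimately show "r = face_radius" by simp
next
  assume rr: "r = face_radius"
  have "foot i \<in> horoball i r" using foot_mem[OF i] rr by (simp add: horoball_def)
  moreover have "horoball i r \<inter> face_hyperplane E i \<subseteq> {foot i}"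
    using horoball_face_bound(2)[OF i r] rr by blast
  ultimately have "horoball i r \<inter> face_hyperplane E i = {foot i}"
    using foot_in_hyperplane(2)[OF i] by blast
  thus "tangent_to_face E i (horoball i r)"
    using foot_in_face[OF i] by (auto simp: tangent_to_face_def)
qed

section \<open>The volume of a horoball sector\<close>

text \<open>
  The vertex vectors are linearly independent because \<open>J - I\<close> is invertible: summing
  \<open>pairing_vertex\<close> over all vertices recovers the sum of the coordinates.
\<close>
lemma coords_unique:
  assumes "mass z = mass z'" "bary z = bary z'" and j: "j \<le> DIM('a)"
  shows "z j = z' j"
proof -
  have eq: "(\<Sum>j\<le>DIM('a). z j) - z i = (\<Sum>j\<le>DIM('a). z' j) - z' i" if "i \<le> DIM('a)" for i
    using pairing_vertex[OF that, of z] pairing_vertex[OF that, of z'] assms by simp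
  have tot: "(\<Sum>i\<le>DIM('a). (\<Sum>j\<le>DIM('a). w j) - w i) = real DIM('a) * (\<Sum>j\<le>DIM('a). w j)" for w :: "nat \<Rightarrow> real"
    by (simp add: sum_subtractf algebra_simps)
  have "(\<Sum>i\<le>DIM('a). (\<Sum>j\<le>DIM('a). z j) - z i) = (\<Sum>i\<le>DIM('a). (\<Sum>j\<le>DIM('a). z' j) - z' i)"
    by (intro sum.cong) (auto simp: eq)
  hence "real DIM('a) * (\<Sum>j\<le>DIM('a). z j) = real DIM('a) * (\<Sum>j\<le>DIM('a). z' j)"
    by (simp only: tot)
  hence "(\<Sum>j\<le>DIM('a). z j) = (\<Sum>j\<le>DIM('a). z' j)" by simp
  thus ?thesis using eq[OF j] by simp
qed

lemma ray_meets_horoball: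
  assumes i: "i \<le> DIM('a)" and l: "l > 0" and r: "r > 0"
  shows "inverse l *\<^sub>R y \<in> horoball i r \<longleftrightarrow>
    0 < l\<^sup>2 - (norm y)\<^sup>2 \<and> (t i * (l - E i \<bullet> y))\<^sup>2 \<le> r\<^sup>2 * (l\<^sup>2 - (norm y)\<^sup>2)"
proof -
  define x where "x = inverse l *\<^sub>R y"
  have y: "y = l *\<^sub>R x" using l by (simp add: x_def)
  have n: "l\<^sup>2 - (norm y)\<^sup>2 = l\<^sup>2 * (1 - (norm x)\<^sup>2)"
    unfolding y by (simp add: power_mult_distrib algebra_simps)
  have e: "t i * (l - E i \<bullet> y) = l * (t i * (1 - E i \<bullet> x))"
    unfolding y by (simp add: algebra_simps)
  have b: "x \<in> ball 0 1 \<longleftrightarrow> 0 < l\<^sup>2 - (norm y)\<^sup>2"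
    unfolding n using l by (simp add: zero_less_mult_iff abs_square_less_1)
  have "t i * (1 - E i \<bullet> x) \<le> r * sqrt (1 - (norm x)\<^sup>2) \<longleftrightarrow>
      (t i * (l - E i \<bullet> y))\<^sup>2 \<le> r\<^sup>2 * (l\<^sup>2 - (norm y)\<^sup>2)" if x: "x \<in> ball 0 1"
  proof -
    have pos: "0 < t i * (1 - E i \<bullet> x)" using t_pos[OF i] vertex_dist_pos[OF i x] by simp
    have s: "0 < r * sqrt (1 - (norm x)\<^sup>2)" using r sqrt_pos[OF x] by simp
    have "t i * (1 - E i \<bullet> x) \<le> r * sqrt (1 - (norm x)\<^sup>2) \<longleftrightarrow>
       (t i * (1 - E i \<bullet> x))\<^sup>2 \<le> (r * sqrt (1 - (norm x)\<^sup>2))\<^sup>2"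
      using pos s by (simp only: abs_le_square_iff[symmetric] abs_of_pos)
    also have "(r * sqrt (1 - (norm x)\<^sup>2))\<^sup>2 = r\<^sup>2 * (1 - (norm x)\<^sup>2)"
      using x by (simp add: power_mult_distrib abs_square_le_1)
    also have "(t i * (1 - E i \<bullet> x))\<^sup>2 \<le> r\<^sup>2 * (1 - (norm x)\<^sup>2) \<longleftrightarrow>
        l\<^sup>2 * (t i * (1 - E i \<bullet> x))\<^sup>2 \<le> l\<^sup>2 * (r\<^sup>2 * (1 - (norm x)\<^sup>2))"
      using l by (simp only: mult_le_cancel_left_pos zero_less_power)
    also have "l\<^sup>2 * (r\<^sup>2 * (1 - (norm x)\<^sup>2)) = r\<^sup>2 * (l\<^sup>2 - (norm y)\<^sup>2)" by (simp only: n mult_ac)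
    also have "l\<^sup>2 * (t i * (1 - E i \<bullet> x))\<^sup>2 = (t i * (l - E i \<bullet> y))\<^sup>2" by (simp only: e power_mult_distrib)
    finally show ?thesis .
  qed
  thus ?thesis unfolding x_def[symmetric] b[symmetric] by (auto simp: horoball_def)
qed

lemma ray_meets_simplex:
  assumes l: "mass z > 0"
  shows "inverse (mass z) *\<^sub>R bary z \<in> simplex_of E \<longleftrightarrow> (\<forall>j\<le>DIM('a). 0 \<le> z j)"
proof
  assume nn: "\<forall>j\<le>DIM('a). 0 \<le> z j"
  have "(\<Sum>j\<le>DIM('a). (inverse (mass z) * (z j * t j)) *\<^sub>R E j) \<in> convex hull (E ` {..DIM('a)})"
  proof (rule convex_sum)
    show "(\<Sum>j\<le>DIM('a). inverse (mass z) * (z j * t j)) = 1"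
      using l by (simp add: sum_distrib_left[symmetric] mass_def[symmetric])
    show "\<And>j. j \<in> {..DIM('a)} \<Longrightarrow> 0 \<le> inverse (mass z) * (z j * t j)"
      using nn l t_pos by (simp add: order_less_imp_le)
    show "\<And>j. j \<in> {..DIM('a)} \<Longrightarrow> E j \<in> convex hull E ` {..DIM('a)}" by (simp add: hull_inc)
  qed auto
  also have "(\<Sum>j\<le>DIM('a). (inverse (mass z) * (z j * t j)) *\<^sub>R E j) = inverse (mass z) *\<^sub>R bary z"
    by (simp add: bary_def scaleR_sum_right)
  finally show "inverse (mass z) *\<^sub>R bary z \<in> simplex_of E" by (simp add: simplex_of_def face_def)
next
  assume "inverse (mass z) *\<^sub>R bary z \<in> simplex_of E"
  then obtain u where u: "\<And>v. v \<in> E ` {..DIM('a)} \<Longrightarrow> 0 \<le> u v" "sum u (E ` {..DIM('a)}) = 1"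
      "(\<Sum>v\<in>E ` {..DIM('a)}. u v *\<^sub>R v) = inverse (mass z) *\<^sub>R bary z"
    by (auto simp: simplex_of_def face_def convex_hull_finite)
  \<comment> \<open>Convex weights \<open>u\<close> give nonnegative coordinates of the same vector, which must be \<open>z\<close>.\<close>
  define z' where "z' = (\<lambda>j. mass z * u (E j) / t j)"
  have zt: "z' j * t j = mass z * u (E j)" if "j \<le> DIM('a)" for j
    using t_pos[OF that] by (simp add: z'_def)
  have "mass z' = (\<Sum>j\<le>DIM('a). mass z * u (E j))" unfolding mass_def[of z'] by (simp add: zt)
  also have "\<dots> = mass z" using u(2) by (simp add: sum.reindex[OF inj_E] sum_distrib_left[symmetric])
  finally have m: "mass z' = mass z" .
  have "bary z' = (\<Sum>j\<le>DIM('a). (mass z * u (E j)) *\<^sub>R E j)" unfolding bary_def[of z'] by (simp add: zt)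
  also have "\<dots> = mass z *\<^sub>R (\<Sum>v\<in>E ` {..DIM('a)}. u v *\<^sub>R v)"
    by (simp add: sum.reindex[OF inj_E] scaleR_sum_right)
  also have "\<dots> = bary z" unfolding u(3) using l by simp
  finally have b: "bary z' = bary z" .
  show "\<forall>j\<le>DIM('a). 0 \<le> z j"
  proof (intro allI impI)
    fix j assume j: "j \<le> DIM('a)"
    have "0 \<le> z' j" using l u(1)[of "E j"] t_pos[OF j] j by (simp add: z'_def)
    thus "0 \<le> z j" using coords_unique[OF m b j] by simp
  qed
qed

lemma horoball_simplex_borel: "horoball i r \<inter> simplex_of E \<in> sets borel"
proof -
  have "closed {x. t i * (1 - E i \<bullet> x) \<le> r * sqrt (1 - (norm x)\<^sup>2)}"
    by (intro closed_Collect_le continuous_intros)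
  moreover have "closed (simplex_of E)" unfolding simplex_of_def face_def
    by (intro compact_imp_closed compact_convex_hull finite_imp_compact) auto
  moreover have "horoball i r = ball 0 1 \<inter> {x. t i * (1 - E i \<bullet> x) \<le> r * sqrt (1 - (norm x)\<^sup>2)}"
    by (auto simp: horoball_def)
  ultimately show ?thesis by (simp add: borel_closed borel_open)
qed

text \<open>
  In the coordinates of the vertex vectors the cone over a horoball sector is
  \<open>cusp_region (\<beta> i) r\<close>, where \<open>\<beta>\<close> enumerates an orthonormal basis of \<open>real \<times> 'a\<close>. The
  Jacobian of the coordinate change is the same for all \<open>i\<close>, and the regions for different
  \<open>i\<close> have equal measure.
\<close>
lemma hvol_horoball_sector:
  obtains C where "C \<ge> 0"
    "\<And>i r. i \<le> DIM('a) \<Longrightarrow> 0 < r \<Longrightarrow> r \<le> face_radius \<Longrightarrow>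
       hvol (horoball i r \<inter> simplex_of E) = C * r ^ (DIM('a) - 1)"
proof -
  have "card {..DIM('a)} = card (Basis :: (real \<times> 'a) set)" by simp
  then obtain \<beta> where \<beta>: "bij_betw \<beta> {..DIM('a)} (Basis :: (real \<times> 'a) set)"
    using finite_same_card_bij[of "{..DIM('a)}" "Basis :: (real \<times> 'a) set"] by auto
  have \<beta>B: "\<beta> j \<in> Basis" if "j \<le> DIM('a)" for j using \<beta> that by (auto simp: bij_betw_def)
  define \<zeta> where "\<zeta> = (\<lambda>(z :: real \<times> 'a) j. z \<bullet> \<beta> j)"
  define L where "L = (\<lambda>z. (mass (\<zeta> z), bary (\<zeta> z)))"
  have One: "z \<bullet> One = (\<Sum>j\<le>DIM('a). \<zeta> z j)" for z
    unfolding inner_sum_right \<zeta>_def by (rule sum.reindex_bij_betw[OF \<beta>, symmetric])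
  have nsq: "(norm z)\<^sup>2 = (\<Sum>j\<le>DIM('a). (\<zeta> z j)\<^sup>2)" for z
  proof -
    have "(norm z)\<^sup>2 = (\<Sum>b\<in>Basis. (z \<bullet> b)\<^sup>2)"
      unfolding power2_norm_eq_inner by (subst euclidean_inner) (simp add: power2_eq_square)
    also have "\<dots> = (\<Sum>j\<le>DIM('a). (\<zeta> z j)\<^sup>2)"
      unfolding \<zeta>_def by (rule sum.reindex_bij_betw[OF \<beta>, symmetric])
    finally show ?thesis .
  qed
  have form: "lorentz_form z = (mass (\<zeta> z))\<^sup>2 - (norm (bary (\<zeta> z)))\<^sup>2" for z
    unfolding lorentz_form_def One nsq pairing_self ..
  have nonneg: "(\<forall>b\<in>Basis. 0 \<le> z \<bullet> b) \<longleftrightarrow> (\<forall>j\<le>DIM('a). 0 \<le> \<zeta> z j)" for z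
    using \<beta> unfolding bij_betw_def \<zeta>_def by (metis (no_types, lifting) atMost_iff imageE imageI)
  have lin: "linear L"
    by (rule linearI)
       (simp_all add: L_def \<zeta>_def mass_def bary_def inner_add_left sum.distrib
          sum_distrib_left scaleR_sum_right algebra_simps)
  have "inj L"
  proof (rule injI)
    fix z z' assume "L z = L z'"
    hence "\<zeta> z j = \<zeta> z' j" if "j \<le> DIM('a)" for j
      using coords_unique[OF _ _ that, of "\<zeta> z" "\<zeta> z'"] by (simp add: L_def)
    moreover have "\<exists>j\<le>DIM('a). b = \<beta> j" if "b \<in> Basis" for b
      using \<beta> that by (auto simp: bij_betw_def)
    ultimately have "z \<bullet> b = z' \<bullet> b" if "b \<in> Basis" for b using that by (metis \<zeta>_def)
    thus "z = z'" by (rule euclidean_eqI)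
  qed
  then obtain G where G: "linear G" "\<And>z. G (L z) = z" "\<And>z. L (G z) = z"
    using linear_injective_isomorphism[OF lin] by blast
  obtain c where c: "\<And>A. A \<in> sets borel \<Longrightarrow> emeasure lborel (G -` A) = c * emeasure lborel A"
    using linear_vimage_lborel[OF G(1) lin G(2)] by blast
  obtain C\<^sub>0 where C0: "\<And>r. 0 < r \<Longrightarrow> r\<^sup>2 * (real DIM('a) - 1) \<le> DIM('a) \<Longrightarrow>
       emeasure lborel (cusp_region ((1, 0) :: real \<times> 'a) r) = ennreal (r ^ (DIM('a) - 1)) * C\<^sub>0"
    using emeasure_cusp_region[where 'a='a] by blast
  define C where "C = ennreal (real DIM('a) + 1) * c * C\<^sub>0"
  show ?thesis
  proof (rule that[of "enn2real C"])
    fix i r assume i: "i \<le> DIM('a)" and r: "0 < r" "r \<le> face_radius"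
    let ?S = "horoball i r \<inter> simplex_of E"
    define K where "K = {z :: real \<times> 'a. 0 < fst z \<and> inverse (fst z) *\<^sub>R snd z \<in> ?S \<and>
                                   (fst z)\<^sup>2 - (norm (snd z))\<^sup>2 \<le> 1}"
    have LK: "L z \<in> K \<longleftrightarrow> z \<in> cusp_region (\<beta> i) r" for z
    proof -
      have v: "z \<bullet> One - z \<bullet> \<beta> i = t i * (mass (\<zeta> z) - E i \<bullet> bary (\<zeta> z))"
        using pairing_vertex[OF i, of "\<zeta> z"] by (simp add: One \<zeta>_def)
      have "L z \<in> K \<longleftrightarrow> 0 < mass (\<zeta> z) \<and> z \<in> cusp_region (\<beta> i) r"
        using ray_meets_horoball[OF i _ r(1), of "mass (\<zeta> z)" "bary (\<zeta> z)"] ray_meets_simplex[of "\<zeta> z"]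
        unfolding K_def L_def cusp_region_def mem_Collect_eq fst_conv snd_conv nonneg form v Int_iff by blast
      moreover have "0 < mass (\<zeta> z)" if "z \<in> cusp_region (\<beta> i) r"
      proof -
        have "\<forall>j\<le>DIM('a). 0 \<le> \<zeta> z j" "0 < lorentz_form z"
          using that unfolding cusp_region_def mem_Collect_eq nonneg by auto
        hence "0 \<le> mass (\<zeta> z)" unfolding mass_def
          using t_pos by (intro sum_nonneg mult_nonneg_nonneg) (auto intro: order_less_imp_le)
        moreover have "mass (\<zeta> z) \<noteq> 0" using \<open>0 < lorentz_form z\<close> by (auto simp: form)
        ultimately show ?thesis by simp
      qed
      ultimately show ?thesis by blast
    qed
    have "K = G -` cusp_region (\<beta> i) r"
    proof (rule set_eqI)
      show "w \<in> K \<longleftrightarrow> w \<in> G -` cusp_region (\<beta> i) r" for w using LK[of "G w"] by (simp add: G)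
    qed
    hence "emeasure lborel K = c * emeasure lborel (cusp_region (\<beta> i) r)"
      using c[OF cusp_region_borel] by simp
    also have "emeasure lborel (cusp_region (\<beta> i) r) = emeasure lborel (cusp_region ((1, 0) :: real \<times> 'a) r)"
      using \<beta>B[OF i] by (rule emeasure_cusp_region_swap) (simp add: Basis_prod_def)
    also have "\<dots> = ennreal (r ^ (DIM('a) - 1)) * C\<^sub>0"
      using C0 r le_face_radius_iff by simp
    finally have "emeasure lborel K = c * (ennreal (r ^ (DIM('a) - 1)) * C\<^sub>0)" .
    moreover have "emeasure hyp_measure ?S = ennreal (real DIM('a) + 1) * emeasure lborel K"
      unfolding K_def
      by (rule emeasure_hyp_measure_cone[OF horoball_simplex_borel]) (auto simp: horoball_def)
    ultimately have "emeasure hyp_measure ?S = C * ennreal (r ^ (DIM('a) - 1))"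
      by (simp add: C_def mult_ac)
    thus "hvol ?S = enn2real C * r ^ (DIM('a) - 1)"
      using r by (simp add: hvol_def measure_def enn2real_mult)
  qed simp
qed

end

section \<open>Maximizing a sum under pairwise product constraints\<close>

text \<open>
  A maximal entry \<open>v > 1\<close> forces all others to be at most \<open>1 / v\<close>. The bound \<open>v + n / v\<close> is
  at most \<open>M + n / M\<close> since the difference is \<open>(M - v) * (v * M - n) / (v * M)\<close>.
\<close>
lemma sum_le_of_pairwise_products:
  fixes u :: "nat \<Rightarrow> real"
  assumes pos: "\<And>i. i \<le> n \<Longrightarrow> 0 < u i" and le: "\<And>i. i \<le> n \<Longrightarrow> u i \<le> M"
    and prod: "\<And>i j. i \<le> n \<Longrightarrow> j \<le> n \<Longrightarrow> i \<noteq> j \<Longrightarrow> u i * u j \<le> 1"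
    and M: "M \<ge> real n" "n \<ge> 1"
  shows "(\<Sum>i\<le>n. u i) \<le> M + real n / M"
proof -
  have "Max (u ` {..n}) \<in> u ` {..n}" by (rule Max_in) auto
  then obtain m where "Max (u ` {..n}) = u m" "m \<in> {..n}" by (rule imageE)
  hence m: "m \<le> n" "u m = Max (u ` {..n})" by simp_all
  define v where "v = u m"
  have max: "u i \<le> v" if "i \<le> n" for i unfolding v_def m(2) using that by (intro Max_ge) auto
  have v: "0 < v" "v \<le> M" using pos[OF m(1)] le[OF m(1)] by (simp_all add: v_def)
  have M1: "M \<ge> 1" using M by linarith
  have gap: "w + real n / w \<le> M + real n / M" if w: "1 \<le> w" "w \<le> M" for w
  proof -
    have "1 * real n \<le> w * M" using w M by (intro mult_mono) auto
    hence "0 \<le> (M - w) * (w * M - real n)" using w by simp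
    hence "0 \<le> (M - w) * (w * M - real n) / (w * M)" using w M1 by (intro divide_nonneg_nonneg) auto
    also have "\<dots> = M + real n / M - (w + real n / w)"
      using w M1 by (simp add: field_simps)
    finally show ?thesis by simp
  qed
  have split: "(\<Sum>i\<le>n. u i) = v + (\<Sum>i\<in>{..n} - {m}. u i)"
    unfolding v_def using m by (intro sum.remove) auto
  show ?thesis
  proof (cases "v \<le> 1")
    case True
    have "(\<Sum>i\<le>n. u i) \<le> (\<Sum>i\<le>n. 1)" using max True by (intro sum_mono) force
    also have "\<dots> = 1 + real n / 1" by simp
    also have "\<dots> \<le> M + real n / M" using gap[of 1] M1 by simp
    finally show ?thesis .
  next
    case False
    have "(\<Sum>i\<in>{..n} - {m}. u i) \<le> (\<Sum>i\<in>{..n} - {m}. 1 / v)"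
    proof (rule sum_mono)
      fix i assume "i \<in> {..n} - {m}"
      hence "u i * v \<le> 1" unfolding v_def using m by (intro prod) auto
      thus "u i \<le> 1 / v" using v by (simp add: pos_le_divide_eq)
    qed
    also have "\<dots> = real n / v" using m by simp
    finally have "(\<Sum>i\<le>n. u i) \<le> v + real n / v" using split by simp
    also have "\<dots> \<le> M + real n / M" using gap[of v] False v by simp
    finally show ?thesis .
  qed
qed

lemma square_le_twice_power:
  fixes m :: nat
  assumes "m \<ge> 3"
  shows "(real m + 1)\<^sup>2 \<le> 2 * 2 ^ m"
  using assms
proof (induction m rule: dec_induct)
  case base
  show ?case by (simp add: power2_eq_square eval_nat_numeral)
next
  case (step m)
  have "(real (Suc m) + 1)\<^sup>2 \<le> 2 * (real m + 1)\<^sup>2"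
  proof -
    have "3 * 3 \<le> real m * real m" using step(1) by (intro mult_mono) auto
    thus ?thesis by (simp add: power2_eq_square algebra_simps)
  qed
  also have "\<dots> \<le> 2 * 2 ^ Suc m" using step.IH by simp
  finally show ?case .
qed

text \<open>
  Bernoulli's inequality gives \<open>2 \<le> (1 + 1 / m) ^ m\<close>, which suffices from \<open>m = 3\<close> on; for
  \<open>m = 1\<close> and \<open>m = 2\<close> both sides are equal, and these are the dimensions 2 and 3 in which
  the two arrangements have the same density.
\<close>
lemma square_le_power_ratio:
  fixes m :: nat
  assumes "m \<ge> 1"
  shows "(real m + 1)\<^sup>2 \<le> (2 * ((real m + 1) / real m)) ^ m"
proof -
  consider "m = 1" | "m = 2" | "m \<ge> 3" using assms by linarith
  thus ?thesis
  proof cases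
    case 3
    have "2 = 1 + real m * (1 / real m)" using 3 by simp
    also have "\<dots> \<le> (1 + 1 / real m) ^ m"
      by (rule Bernoulli_inequality) (use 3 in \<open>simp add: divide_simps\<close>)
    also have "1 + 1 / real m = (real m + 1) / real m" using 3 by (simp add: field_simps)
    finally have "2 ^ m * 2 \<le> 2 ^ m * ((real m + 1) / real m) ^ m"
      by (intro mult_left_mono) auto
    hence "2 * 2 ^ m \<le> (2 * ((real m + 1) / real m)) ^ m"
      by (simp only: power_mult_distrib mult.commute)
    thus ?thesis using square_le_twice_power[OF 3] by linarith
  qed (simp_all add: power2_eq_square)
qed

context gauged_simplex
begin

section \<open>Optimal horoball arrangements\<close>

definition admissible_radii :: "(nat \<Rightarrow> real) \<Rightarrow> bool" where
  "admissible_radii r \<longleftrightarrow> (\<forall>i\<le>DIM('a). 0 < r i \<and> r i \<le> face_radius) \<and>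
     (\<forall>i\<le>DIM('a). \<forall>j\<le>DIM('a). i \<noteq> j \<longrightarrow> r i * r j \<le> 1 / 2)"

lemma horoball_familyE:
  assumes "horoball_family E B"
  obtains r where "\<And>i. i \<le> DIM('a) \<Longrightarrow> 0 < r i" "\<And>i. i \<le> DIM('a) \<Longrightarrow> B i = horoball i (r i)"
proof -
  have "\<forall>i\<in>{..DIM('a)}. \<exists>r>0. B i = horoball i r"
    using assms is_horoball_iff by (auto simp: horoball_family_def)
  then obtain r where "\<forall>i\<in>{..DIM('a)}. 0 < r i \<and> B i = horoball i (r i)"
    using bchoice by metis
  thus ?thesis using that by auto
qed

lemma horoball_familyI:
  assumes "\<And>i. i \<le> DIM('a) \<Longrightarrow> 0 < r i" "\<And>i. i \<le> DIM('a) \<Longrightarrow> B i = horoball i (r i)"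
  shows "horoball_family E B"
  using assms is_horoball_iff by (auto simp: horoball_family_def)

lemma admissible_iff_radii:
  assumes r: "\<And>i. i \<le> DIM('a) \<Longrightarrow> 0 < r i" and B: "\<And>i. i \<le> DIM('a) \<Longrightarrow> B i = horoball i (r i)"
  shows "admissible E B \<longleftrightarrow> admissible_radii r"
proof -
  have 1: "interior (B i) \<inter> interior (B j) = {} \<longleftrightarrow> r i * r j \<le> 1 / 2"
    if "i \<le> DIM('a)" "j \<le> DIM('a)" "i \<noteq> j" for i j
    using horoballs_not_overlapping_iff[OF that] r B that by simp
  have 2: "(\<exists>p. B i \<inter> face_hyperplane E i \<subseteq> {p}) \<longleftrightarrow> r i \<le> face_radius" if "i \<le> DIM('a)" for i
    using horoball_within_face_iff[OF that r[OF that]] B[OF that] by simp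
  show ?thesis
    unfolding admissible_def admissible_radii_def
    using horoball_familyI[OF r B] r 1 2 by auto
qed

text \<open>
  The bound \<open>M\<close> on \<open>u i = (sqrt 2 * r i) ^ (n - 1)\<close> that the face condition imposes.
\<close>
definition max_weight :: real where
  "max_weight = (sqrt 2 * face_radius) ^ (DIM('a) - 1)"

lemma max_weight_pos: "max_weight > 0"
  using face_radius_pos by (simp add: max_weight_def)

lemma max_weight_sq: "max_weight\<^sup>2 = (2 * (real DIM('a) / (real DIM('a) - 1))) ^ (DIM('a) - 1)"
proof -
  have "max_weight\<^sup>2 = ((sqrt 2 * face_radius)\<^sup>2) ^ (DIM('a) - 1)"
    by (simp add: max_weight_def power_mult[symmetric] mult.commute)
  also have "(sqrt 2 * face_radius)\<^sup>2 = 2 * (real DIM('a) / (real DIM('a) - 1))"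
    by (simp only: power_mult_distrib face_radius_sq real_sqrt_pow2)
  finally show ?thesis .
qed

lemma dim_le_max_weight: "real DIM('a) \<le> max_weight"
proof (rule power2_le_imp_le)
  have "real (DIM('a) - 1) + 1 = real DIM('a)" using dim by simp
  moreover have "real (DIM('a) - 1) = real DIM('a) - 1" using dim by simp
  ultimately show "(real DIM('a))\<^sup>2 \<le> max_weight\<^sup>2"
    unfolding max_weight_sq using square_le_power_ratio[of "DIM('a) - 1"] dim by simp
qed (use max_weight_pos in auto)

lemma max_weight_eq_dim:
  assumes "DIM('a) = 2 \<or> DIM('a) = 3"
  shows "max_weight = real DIM('a)"
proof -
  have "max_weight\<^sup>2 = (real DIM('a))\<^sup>2"
    unfolding max_weight_sq using assms by (elim disjE) (simp_all add: power2_eq_square)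
  thus ?thesis using max_weight_pos by (simp add: power2_eq_iff_nonneg)
qed

lemma density_formula:
  obtains D where "D \<ge> 0"
    "\<And>r B. admissible_radii r \<Longrightarrow> (\<And>i. i \<le> DIM('a) \<Longrightarrow> B i = horoball i (r i)) \<Longrightarrow>
       horoball_density E B = D * (\<Sum>i\<le>DIM('a). (sqrt 2 * r i) ^ (DIM('a) - 1))"
proof -
  obtain C where C: "C \<ge> 0"
    "\<And>i r. i \<le> DIM('a) \<Longrightarrow> 0 < r \<Longrightarrow> r \<le> face_radius \<Longrightarrow>
       hvol (horoball i r \<inter> simplex_of E) = C * r ^ (DIM('a) - 1)"
    using hvol_horoball_sector by blast
  let ?s = "sqrt 2 ^ (DIM('a) - 1)"
  define D where "D = C / ?s / hvol (simplex_of E)"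
  show ?thesis
  proof (rule that[of D])
    show "D \<ge> 0" using C(1) by (simp add: D_def hvol_def)
    fix r B assume r: "admissible_radii r" and B: "\<And>i. i \<le> DIM('a) \<Longrightarrow> B i = horoball i (r i)"
    have "(\<Sum>i\<le>DIM('a). hvol (B i \<inter> simplex_of E)) = (\<Sum>i\<le>DIM('a). C * r i ^ (DIM('a) - 1))"
      using r B C(2) by (intro sum.cong) (auto simp: admissible_radii_def)
    also have "\<dots> = C / ?s * (\<Sum>i\<le>DIM('a). (sqrt 2 * r i) ^ (DIM('a) - 1))"
      by (simp add: sum_distrib_left power_mult_distrib)
    finally show "horoball_density E B = D * (\<Sum>i\<le>DIM('a). (sqrt 2 * r i) ^ (DIM('a) - 1))"
      by (simp add: horoball_density_def D_def)
  qed
qed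

lemma admissible_radii_sum_le:
  assumes r: "admissible_radii r"
  shows "(\<Sum>i\<le>DIM('a). (sqrt 2 * r i) ^ (DIM('a) - 1)) \<le> max_weight + real DIM('a) / max_weight"
proof (rule sum_le_of_pairwise_products)
  show "0 < (sqrt 2 * r i) ^ (DIM('a) - 1)" if "i \<le> DIM('a)" for i
    using r that by (auto simp: admissible_radii_def)
  show "(sqrt 2 * r i) ^ (DIM('a) - 1) \<le> max_weight" if "i \<le> DIM('a)" for i
  proof -
    have "0 < r i" "r i \<le> face_radius" using r that by (auto simp: admissible_radii_def)
    thus ?thesis unfolding max_weight_def by (intro power_mono mult_left_mono mult_nonneg_nonneg) auto
  qed
  show "(sqrt 2 * r i) ^ (DIM('a) - 1) * (sqrt 2 * r j) ^ (DIM('a) - 1) \<le> 1"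
    if "i \<le> DIM('a)" "j \<le> DIM('a)" "i \<noteq> j" for i j
  proof -
    have p: "0 < r i" "0 < r j" "r i * r j \<le> 1 / 2" using r that by (auto simp: admissible_radii_def)
    have "(sqrt 2 * r i) * (sqrt 2 * r j) = 2 * (r i * r j)" by simp
    also have "\<dots> \<le> 1" using p by simp
    finally have "((sqrt 2 * r i) * (sqrt 2 * r j)) ^ (DIM('a) - 1) \<le> 1"
      using p by (intro power_le_one) auto
    thus ?thesis by (simp only: power_mult_distrib)
  qed
qed (use dim_le_max_weight dim in auto)

lemma density_maximal_of_radii:
  assumes r: "admissible_radii r" and B: "\<And>i. i \<le> DIM('a) \<Longrightarrow> B i = horoball i (r i)"
    and opt: "(\<Sum>i\<le>DIM('a). (sqrt 2 * r i) ^ (DIM('a) - 1)) = max_weight + real DIM('a) / max_weight"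
  shows "density_maximal E B"
proof -
  obtain D where D: "D \<ge> 0"
    "\<And>r B. admissible_radii r \<Longrightarrow> (\<And>i. i \<le> DIM('a) \<Longrightarrow> B i = horoball i (r i)) \<Longrightarrow>
       horoball_density E B = D * (\<Sum>i\<le>DIM('a). (sqrt 2 * r i) ^ (DIM('a) - 1))"
    using density_formula by blast
  have rpos: "\<And>i. i \<le> DIM('a) \<Longrightarrow> 0 < r i" using r by (auto simp: admissible_radii_def)
  have adm: "admissible E B" using admissible_iff_radii[OF rpos B] r by blast
  have "horoball_density E B' \<le> horoball_density E B" if B': "admissible E B'" for B'
  proof -
    obtain s where s: "\<And>i. i \<le> DIM('a) \<Longrightarrow> 0 < s i" "\<And>i. i \<le> DIM('a) \<Longrightarrow> B' i = horoball i (s i)"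
      using horoball_familyE B' by (metis admissible_def)
    have s': "admissible_radii s" using admissible_iff_radii[OF s] B' by blast
    have "D * (\<Sum>i\<le>DIM('a). (sqrt 2 * s i) ^ (DIM('a) - 1)) \<le> D * (max_weight + real DIM('a) / max_weight)"
      using admissible_radii_sum_le[OF s'] D(1) by (rule mult_left_mono)
    thus ?thesis using D(2)[OF s' s(2)] D(2)[OF r B] opt by simp
  qed
  thus ?thesis using adm by (simp add: density_maximal_def)
qed

lemma face_radius_gt_1: "face_radius > 1"
  using dim by (simp add: face_radius_def)

text \<open>
  Any three indices have pairwise products 1/2, so all radii are equal; this uses that there
  are at least three vertices.
\<close>
lemma arrangement0_horoballs:
  assumes "arrangement0 E B" and i: "i \<le> DIM('a)"
  shows "B i = horoball i (1 / sqrt 2)"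
proof -
  obtain r where r: "\<And>i. i \<le> DIM('a) \<Longrightarrow> 0 < r i" "\<And>i. i \<le> DIM('a) \<Longrightarrow> B i = horoball i (r i)"
    using assms horoball_familyE by (metis arrangement0_def)
  have prod: "r i * r j = 1 / 2" if "i \<le> DIM('a)" "j \<le> DIM('a)" "i \<noteq> j" for i j
  proof -
    have "horoballs_tangent (B i) (B j)" using assms(1) that by (simp add: arrangement0_def)
    thus ?thesis
      using horoballs_tangent_iff[OF that r(1)[OF that(1)] r(1)[OF that(2)]] r(2) that by simp
  qed
  obtain j k where jk: "j \<le> DIM('a)" "k \<le> DIM('a)" "j \<noteq> i" "k \<noteq> i" "j \<noteq> k"
  proof -
    have "2 \<le> card ({..DIM('a)} - {i})" using i dim by simp
    then obtain j k where "j \<in> {..DIM('a)} - {i}" "k \<in> {..DIM('a)} - {i}" "j \<noteq> k"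
      by (metis card_le_Suc0_iff_eq finite_Diff finite_atMost not_less_eq_eq numeral_2_eq_2)
    thus ?thesis using that by auto
  qed
  have "r i * r j = 1 / 2" "r k * r j = 1 / 2" "r i * r k = 1 / 2" using prod i jk by blast+
  moreover from this have "r i = r k"
    using r(1)[OF jk(1)] by (metis less_irrefl mult_right_cancel)
  ultimately have "(r i)\<^sup>2 = 1 / 2" by (simp add: power2_eq_square)
  hence "r i = sqrt (1 / 2)" using r(1)[OF i] by (metis less_imp_le real_sqrt_unique)
  thus ?thesis using r(2)[OF i] by (simp add: real_sqrt_divide)
qed

lemma equal_radii_admissible: "admissible_radii (\<lambda>_. 1 / sqrt 2)"
proof -
  have "1 / sqrt 2 \<le> 1" by simp
  also note less_imp_le[OF face_radius_gt_1]
  finally show ?thesis by (simp add: admissible_radii_def)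
qed

lemma arrangement0_exists: "\<exists>B. arrangement0 E B"
proof
  let ?B = "\<lambda>i. horoball i (1 / sqrt 2)"
  obtain C where "C \<ge> 0" and C:
    "\<And>i r. i \<le> DIM('a) \<Longrightarrow> 0 < r \<Longrightarrow> r \<le> face_radius \<Longrightarrow>
       hvol (horoball i r \<inter> simplex_of E) = C * r ^ (DIM('a) - 1)"
    using hvol_horoball_sector by blast
  have "1 / sqrt 2 \<le> face_radius"
    using equal_radii_admissible by (auto simp: admissible_radii_def)
  hence "hvol (?B i \<inter> simplex_of E) = C * (1 / sqrt 2) ^ (DIM('a) - 1)" if "i \<le> DIM('a)" for i
    using C[OF that] by simp
  moreover have "horoball_family E ?B" by (rule horoball_familyI[of "\<lambda>_. 1 / sqrt 2"]) auto
  moreover have "horoballs_tangent (?B i) (?B j)" if "i \<le> DIM('a)" "j \<le> DIM('a)" "i \<noteq> j" for i j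
    using horoballs_tangent_iff[OF that] by simp
  ultimately show "arrangement0 E ?B" by (simp add: arrangement0_def)
qed

lemma arrangement0_maximal:
  assumes n: "DIM('a) = 2 \<or> DIM('a) = 3" and B: "arrangement0 E B"
  shows "density_maximal E B"
proof (rule density_maximal_of_radii[OF equal_radii_admissible])
  show "B i = horoball i (1 / sqrt 2)" if "i \<le> DIM('a)" for i
    using arrangement0_horoballs[OF B that] .
  show "(\<Sum>i\<le>DIM('a). (sqrt 2 * (1 / sqrt 2)) ^ (DIM('a) - 1)) = max_weight + real DIM('a) / max_weight"
    using max_weight_eq_dim[OF n] by simp
qed

definition arrangement1_radii :: "nat \<Rightarrow> real" where
  "arrangement1_radii i = (if i = DIM('a) then face_radius else 1 / (2 * face_radius))"

lemma arrangement1_radii_admissible: "admissible_radii arrangement1_radii"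
proof -
  have R: "face_radius > 1" by (rule face_radius_gt_1)
  have le: "1 / (2 * face_radius) \<le> 1 / 2" using R by (simp add: field_simps)
  have each: "0 < arrangement1_radii i \<and> arrangement1_radii i \<le> face_radius" for i
  proof -
    have "0 < 1 / (2 * face_radius)" "1 / (2 * face_radius) \<le> face_radius" "0 < face_radius"
      using R le by (simp, linarith, linarith)
    thus ?thesis unfolding arrangement1_radii_def by (simp only: split: if_split) blast
  qed
  have small: "1 / (2 * face_radius) * (1 / (2 * face_radius)) \<le> 1 / 2 * 1"
    using R le by (intro mult_mono) auto
  have large: "face_radius * (1 / (2 * face_radius)) = 1 / 2" using R by simp
  have "arrangement1_radii i * arrangement1_radii j \<le> 1 / 2" if ij: "i \<noteq> j" for i j
  proof -
    consider "i = DIM('a)" "j \<noteq> DIM('a)" | "i \<noteq> DIM('a)" "j = DIM('a)" | "i \<noteq> DIM('a)" "j \<noteq> DIM('a)"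
      using ij by blast
    thus ?thesis
    proof cases
      case 1
      hence "arrangement1_radii i * arrangement1_radii j = 1 / 2"
        using large by (simp only: arrangement1_radii_def refl if_True if_False)
      thus ?thesis by simp
    next
      case 2
      hence "arrangement1_radii j * arrangement1_radii i = 1 / 2"
        using large by (simp only: arrangement1_radii_def refl if_True if_False)
      thus ?thesis by (simp add: mult.commute)
    next
      case 3
      hence "arrangement1_radii i * arrangement1_radii j = 1 / (2 * face_radius) * (1 / (2 * face_radius))"
        by (simp only: arrangement1_radii_def if_False)
      thus ?thesis using small by linarith
    qed
  qed
  thus ?thesis using each by (simp only: admissible_radii_def) blast
qed

text \<open>
  Both tangency conditions are equations for the radii: the first fixes \<open>r n\<close>, the others
  \<open>r i * r n = 1 / 2\<close>.
\<close>
lemma arrangement1_iff: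
  "arrangement1 E B \<longleftrightarrow> (\<forall>i\<le>DIM('a). B i = horoball i (arrangement1_radii i))"
proof
  assume B: "arrangement1 E B"
  obtain r where r: "\<And>i. i \<le> DIM('a) \<Longrightarrow> 0 < r i" "\<And>i. i \<le> DIM('a) \<Longrightarrow> B i = horoball i (r i)"
    using B horoball_familyE by (metis arrangement1_def)
  have rn: "r DIM('a) = face_radius"
    using B tangent_to_face_iff[OF order_refl r(1)] r(2) by (simp add: arrangement1_def)
  have "r i = arrangement1_radii i" if "i \<le> DIM('a)" for i
  proof (cases "i = DIM('a)")
    case False
    hence "horoballs_tangent (B i) (B DIM('a))" using B that by (simp add: arrangement1_def)
    hence "r i * face_radius = 1 / 2"
      using horoballs_tangent_iff[OF that order_refl False r(1)[OF that] r(1)[OF order_refl]]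
        r(2)[OF that] r(2)[OF order_refl] rn by simp
    thus ?thesis using False face_radius_pos by (simp add: arrangement1_radii_def field_simps)
  qed (simp add: rn arrangement1_radii_def)
  thus "\<forall>i\<le>DIM('a). B i = horoball i (arrangement1_radii i)" using r(2) by simp
next
  assume B: "\<forall>i\<le>DIM('a). B i = horoball i (arrangement1_radii i)"
  have pos: "0 < arrangement1_radii i" for i using face_radius_pos by (simp add: arrangement1_radii_def)
  have "horoball_family E B" by (rule horoball_familyI[of arrangement1_radii]) (use pos B in auto)
  moreover have "tangent_to_face E DIM('a) (B DIM('a))"
    using B tangent_to_face_iff[OF order_refl pos[of "DIM('a)"]] by (simp add: arrangement1_radii_def)
  moreover have "horoballs_tangent (B i) (B DIM('a))" if "i < DIM('a)" for i
  proof -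
    have "arrangement1_radii i * arrangement1_radii DIM('a) = 1 / 2"
      using that face_radius_pos by (simp add: arrangement1_radii_def)
    hence "horoballs_tangent (horoball i (arrangement1_radii i)) (horoball DIM('a) (arrangement1_radii DIM('a)))"
      using that pos by (subst horoballs_tangent_iff) auto
    thus ?thesis using B that by simp
  qed
  ultimately show "arrangement1 E B" by (simp add: arrangement1_def)
qed

lemma arrangement1_maximal:
  assumes B: "arrangement1 E B"
  shows "density_maximal E B"
proof (rule density_maximal_of_radii[OF arrangement1_radii_admissible])
  show "B i = horoball i (arrangement1_radii i)" if "i \<le> DIM('a)" for i
    using B that by (simp add: arrangement1_iff)
  have "sqrt 2 * (1 / (2 * face_radius)) = 1 / (sqrt 2 * face_radius)"
    using face_radius_pos by (simp add: field_simps)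
  hence "(sqrt 2 * arrangement1_radii i) ^ (DIM('a) - 1) = 1 / max_weight" if "i < DIM('a)" for i
    using that by (simp add: arrangement1_radii_def max_weight_def power_divide)
  hence "(\<Sum>i<DIM('a). (sqrt 2 * arrangement1_radii i) ^ (DIM('a) - 1)) = real DIM('a) / max_weight" by simp
  moreover have "(sqrt 2 * arrangement1_radii DIM('a)) ^ (DIM('a) - 1) = max_weight"
    by (simp add: arrangement1_radii_def max_weight_def)
  ultimately show "(\<Sum>i\<le>DIM('a). (sqrt 2 * arrangement1_radii i) ^ (DIM('a) - 1)) = max_weight + real DIM('a) / max_weight"
    by (simp add: lessThan_Suc_atMost[symmetric])
qed

lemma arrangement1_exists: "\<exists>B. arrangement1 E B"
  by (rule exI[of _ "\<lambda>i. horoball i (arrangement1_radii i)"]) (simp add: arrangement1_iff)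

end

theorem theorem3p6:
  fixes E :: "nat \<Rightarrow> 'a::euclidean_space"
  assumes "DIM('a) \<ge> 2"
    and "regular_ideal_simplex E"
  shows "(DIM('a) = 2 \<or> DIM('a) = 3 \<longrightarrow>
            (\<exists>B. arrangement0 E B) \<and> (\<forall>B. arrangement0 E B \<longrightarrow> density_maximal E B) \<and>
            (\<exists>B. arrangement1 E B) \<and> (\<forall>B. arrangement1 E B \<longrightarrow> density_maximal E B))
       \<and> (DIM('a) \<ge> 4 \<longrightarrow>
            (\<exists>B. arrangement1 E B) \<and> (\<forall>B. arrangement1 E B \<longrightarrow> density_maximal E B))"
proof -
  obtain t where t: "\<And>i. i \<le> DIM('a) \<Longrightarrow> t i > 0"
    "\<And>i j. i \<le> DIM('a) \<Longrightarrow> j \<le> DIM('a) \<Longrightarrow> i \<noteq> j \<Longrightarrow> t i * t j * (1 - E i \<bullet> E j) = 1"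
    using regular_ideal_simplex_gauge[OF assms] by blast
  interpret gauged_simplex E t
  proof
    show "norm (E i) = 1" if "i \<le> DIM('a)" for i
      using assms(2) that by (simp add: regular_ideal_simplex_def ideal_simplex_def)
  qed (use assms(1) t in auto)
  show ?thesis
    using arrangement0_exists arrangement0_maximal arrangement1_exists arrangement1_maximal by blast
qed

end
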